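(* For every integer $n\ge 1$, \[\mathsf{Pop}(\mathrm{Tam}(B_n);q)=\sum_{k\ge 0}\binom{n-1}{k}\binom{n-k+1}{k}q^{n-k}.\]
   Context: For a finite lattice $M$ and $x\in M$, $\mathsf{Pop}_M(x)$ is the meet of $x$ together with all elements covered by $x$; $\mathscr{U}_M(x)$ is the set of elements covering $x$; $\mathsf{Pop}(M;q)=\sum_{b\in\mathsf{Pop}_M(M)} q^{|\mathscr{U}_M(b)|}$. Let $B_n$ be the set of permutations $x=x_1\cdots x_{2n}$ of $\{1,\dots,2n\}$ with $x_i+x_{2n+1-i}=2n+1$ for all $i$, ordered by the (right) weak order: $x\le y$ iff every pair of values $a<b$ with $b$ before $a$ in $x$ also has $b$ before $a$ in $y$. An element $x\in B_n$ contains a $312^*$ pattern if there are $i<j<k$ with $x_j<x_k<x_i$ and $x_k\ge n+1$. $\mathrm{Tam}(B_n)$ is the set of elements of $B_n$ avoiding $312^*$ patterns, with the order induced from the weak order on $B_n$ (the type $B$ Tamari lattice); covers and meets are taken in this lattice. *)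

theory Defs
  imports
    "HOL-Library.Groups_Big_Fun"
    "HOL-Computational_Algebra.Polynomial"
    "HOL-Combinatorics.Permutations"
    "HOL-Algebra.Lattice"
begin

definition covered_by :: "('a, 'm) gorder_scheme \<Rightarrow> 'a \<Rightarrow> 'a \<Rightarrow> bool" where
  "covered_by M y x \<longleftrightarrow>
     x \<in> carrier M \<and> y \<in> carrier M \<and> y \<sqsubset>\<^bsub>M\<^esub> x \<and>
     \<not> (\<exists>z\<in>carrier M. y \<sqsubset>\<^bsub>M\<^esub> z \<and> z \<sqsubset>\<^bsub>M\<^esub> x)"

definition upper_covers :: "('a, 'm) gorder_scheme \<Rightarrow> 'a \<Rightarrow> 'a set" where
  "upper_covers M x = {y. covered_by M x y}"

(* The library infimum is a Hilbert choice among the greatest lower bounds; the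
   definition is meant for lattices M with eq M = (=), where that bound exists
   and is unique. *)
definition Pop :: "('a, 'm) gorder_scheme \<Rightarrow> 'a \<Rightarrow> 'a" where
  "Pop M x = \<Sqinter>\<^bsub>M\<^esub> (insert x {y. covered_by M y x})"

(* The sum is over distinct elements b of the image of Pop; the indeterminate q is
   the polynomial variable, so monom 1 d is q^d. *)
definition Pop_poly :: "('a, 'm) gorder_scheme \<Rightarrow> int poly" where
  "Pop_poly M = (\<Sum>b\<in>Pop M ` carrier M. monom 1 (card (upper_covers M b)))"

(* A word x_1 ... x_{2n} is the function i |-> x_i, which by "permutes" is the
   identity off {1..2n}; equality of words is therefore equality of functions. *)
definition B_perms :: "nat \<Rightarrow> (nat \<Rightarrow> nat) set" where
  "B_perms n = {x. x permutes {1..2 * n} \<and>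
                   (\<forall>i\<in>{1..2 * n}. x i + x (2 * n + 1 - i) = 2 * n + 1)}"

(* Positions need no bound: a permutation of {1..2n} fixes every other position, which
   therefore never takes part in a pair a < b with b before a. *)
definition before :: "(nat \<Rightarrow> nat) \<Rightarrow> nat \<Rightarrow> nat \<Rightarrow> bool" where
  "before x b a \<longleftrightarrow> (\<exists>i j. i < j \<and> x i = b \<and> x j = a)"

definition weak_le :: "(nat \<Rightarrow> nat) \<Rightarrow> (nat \<Rightarrow> nat) \<Rightarrow> bool" where
  "weak_le x y \<longleftrightarrow> (\<forall>a b. a < b \<and> before x b a \<longrightarrow> before y b a)"

definition contains_312star :: "nat \<Rightarrow> (nat \<Rightarrow> nat) \<Rightarrow> bool" where
  "contains_312star n x \<longleftrightarrow>
     (\<exists>i j k. 1 \<le> i \<and> i < j \<and> j < k \<and> k \<le> 2 * n \<and>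
              x j < x k \<and> x k < x i \<and> n + 1 \<le> x k)"

definition TamB :: "nat \<Rightarrow> (nat \<Rightarrow> nat) gorder" where
  "TamB n = \<lparr>carrier = {x \<in> B_perms n. \<not> contains_312star n x},
             eq = (=), le = weak_le\<rparr>"

end

(* A word is recorded by the function f that sends a signed value a to the largest positive
   value c >= a standing at or before a (0 if there is none): avoiding 312* means that the
   positive values c > a to the left of a are the first ones above a, without gaps. The weak order becomes the pointwise order of these
   functions. On the positive values f is a plane forest in preorder (f i is the last node of
   the subtree of i), on the negative values it is a self-conjugate partition whose steps may
   only be taken at the ends of the trees.

   Pop removes the last child of every node of the forest and all corners of the partition.
   Hence f is in the image iff every last child is a leaf, every run of trees not separated by
   the partition ends in a leaf, and the partition is not the full square. An element of the
   image has a staircase partition, so it is determined by its forest together with the set of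
   the cuts and one bit. Reading the nodes from right to left, with an up step for a leaf that
   is a last child or a cut and a down step for an inner node, turns it into a Motzkin path
   that may end at any height. The reflection principle counts these paths. *)

theory Submission
  imports Defs
begin

section \<open>Counting Motzkin paths\<close>

text \<open>A pair of values a < c with c in front of a is visible in \<open>f\<close> as
  \<open>c <= f a\<close> if c > 0; if c < 0, its mirror image (-c, -a) has a positive larger value.
  So \<open>f\<close> stores every inversion, conjugacy of the partition is the symmetry of the
  word, and laminarity is transitivity of standing in front. Since steps of the partition are
  confined to ends of trees, a corner is never a single cell by nature: it is the rectangle of a
  tree of rows and a tree of columns, removed or added together with its mirror image. An element of
  the image has one upper cover for each letter that is not an up step, and one for each mirror pair
  of staircase corners, about half the number of cuts. A word of final height k thus gets the extra
  weight \<open>run_weight k\<close>, which satisfies run_weight (k + 2) = q * run_weight k, plus q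
  if k = 0. The reflection formula N_k - q N_(k+2) telescopes against it to q (N_0 + 2 N_1 + N_2),
  and Pascal's rule applied twice turns 1 + 2 + 1 into the n - k + 1 of the claimed
  binomial.\<close>

datatype step = Up | Level | Down

text \<open>The words are read from right to left, \<open>k\<close> being the final height.\<close>

fun motzkin :: "nat \<Rightarrow> step list \<Rightarrow> bool" where
  "motzkin k [] \<longleftrightarrow> k = 0"
| "motzkin k (Up # w) \<longleftrightarrow> k > 0 \<and> motzkin (k - 1) w"
| "motzkin k (Level # w) \<longleftrightarrow> motzkin k w"
| "motzkin k (Down # w) \<longleftrightarrow> motzkin (Suc k) w"

definition motzkin_words :: "nat \<Rightarrow> nat \<Rightarrow> step list set" where
  "motzkin_words m k = {w. length w = m \<and> motzkin k w}"

definition non_ups :: "step list \<Rightarrow> nat" where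
  "non_ups w = length (filter (\<lambda>s. s \<noteq> Up) w)"

definition motzkin_poly :: "nat \<Rightarrow> nat \<Rightarrow> int poly" where
  "motzkin_poly m k = (\<Sum>w\<in>motzkin_words m k. monom 1 (non_ups w))"

lemma motzkin_height_unique: "motzkin k w \<Longrightarrow> motzkin l w \<Longrightarrow> k = l"
proof (induction w arbitrary: k l)
  case (Cons s w)
  show ?case
  proof (cases s)
    case Up
    with Cons.prems Cons.IH[of "k - 1" "l - 1"] show ?thesis by auto
  qed (use Cons in auto)
qed simp

lemma motzkin_height_le: "motzkin k w \<Longrightarrow> k \<le> length w"
proof (induction w arbitrary: k)
  case (Cons s w)
  show ?case
  proof (cases s)
    case Up
    with Cons.prems Cons.IH[of "k - 1"] show ?thesis by simp
  next
    case Level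
    with Cons.prems Cons.IH[of k] show ?thesis by simp
  next
    case Down
    with Cons.prems Cons.IH[of "Suc k"] show ?thesis by simp
  qed
qed simp

lemma finite_motzkin_words [simp]: "finite (motzkin_words m k)"
proof -
  have "UNIV = {Up, Level, Down}"
    using step.exhaust by auto
  hence "finite (UNIV :: step set)"
    by (metis finite.emptyI finite_insert)
  hence "finite {w :: step list. set w \<subseteq> UNIV \<and> length w = m}"
    by (rule finite_lists_length_eq)
  thus ?thesis
    by (rule rev_finite_subset) (auto simp: motzkin_words_def)
qed

lemma motzkin_words_Suc:
  "motzkin_words (Suc m) k =
     (if k > 0 then (#) Up ` motzkin_words m (k - 1) else {}) \<union>
     ((#) Level ` motzkin_words m k \<union> (#) Down ` motzkin_words m (Suc k))"
proof (intro Set.set_eqI iffI)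
  fix w assume "w \<in> motzkin_words (Suc m) k"
  then obtain s v where "w = s # v" "length v = m" "motzkin k (s # v)"
    by (auto simp: motzkin_words_def length_Suc_conv)
  thus "w \<in> (if k > 0 then (#) Up ` motzkin_words m (k - 1) else {}) \<union>
     ((#) Level ` motzkin_words m k \<union> (#) Down ` motzkin_words m (Suc k))"
    by (cases s) (auto simp: motzkin_words_def)
qed (auto simp: motzkin_words_def split: if_splits)

lemma motzkin_poly_0: "motzkin_poly 0 k = (if k = 0 then 1 else 0)"
proof -
  have "motzkin_words 0 k = (if k = 0 then {[]} else {})"
    by (auto simp: motzkin_words_def)
  thus ?thesis by (simp add: motzkin_poly_def non_ups_def)
qed

lemma motzkin_poly_Suc:
  "motzkin_poly (Suc m) k =
     (if k > 0 then motzkin_poly m (k - 1) else 0) +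
     pCons 0 (motzkin_poly m k + motzkin_poly m (Suc k))"
proof -
  have shift: "(\<Sum>w\<in>(#) s ` A. monom (1::int) (non_ups w)) =
      (if s = Up then (\<Sum>w\<in>A. monom 1 (non_ups w)) else pCons 0 (\<Sum>w\<in>A. monom 1 (non_ups w)))"
    if "finite A" for s and A :: "step list set"
  proof -
    have "(\<Sum>w\<in>(#) s ` A. monom (1::int) (non_ups w)) = (\<Sum>w\<in>A. monom 1 (non_ups (s # w)))"
      by (subst sum.reindex) (auto simp: inj_on_def)
    also have "\<dots> = (if s = Up then (\<Sum>w\<in>A. monom 1 (non_ups w)) else pCons 0 (\<Sum>w\<in>A. monom 1 (non_ups w)))"
      using that by (induction A rule: finite_induct) (auto simp: non_ups_def monom_Suc)
    finally show ?thesis .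
  qed
  show ?thesis
    unfolding motzkin_poly_def motzkin_words_Suc
    by (subst sum.union_disjoint; auto simp: shift)+
qed

text \<open>Counts unrestricted words of length \<open>m\<close> with \<open>e\<close> up steps and
  final height \<open>k\<close>: the up positions are chosen first, then the \<open>e - k\<close>
  down positions. On \<open>nat\<close> the guard matters, since for \<open>k > e\<close> the
  truncated difference would make the second binomial 1.\<close>

definition steps :: "nat \<Rightarrow> nat \<Rightarrow> nat \<Rightarrow> nat" where
  "steps m e k = (m choose e) * (if k \<le> e then (m - e) choose (e - k) else 0)"

definition grand_poly :: "nat \<Rightarrow> nat \<Rightarrow> int poly" where
  "grand_poly m k = (\<Sum>e\<le>m. monom (int (steps m e k)) (m - e))"

lemma coeff_grand_poly:
  "coeff (grand_poly m k) j = (if j \<le> m then int (steps m (m - j) k) else 0)"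
proof -
  have "coeff (grand_poly m k) j = (\<Sum>e\<le>m. if m - e = j then int (steps m e k) else 0)"
    by (simp add: grand_poly_def coeff_sum)
  also have "\<dots> = (\<Sum>e\<in>{e. e \<le> m \<and> m - e = j}. int (steps m e k))"
    by (rule sum.mono_neutral_cong_right) auto
  also have "{e. e \<le> m \<and> m - e = j} = (if j \<le> m then {m - j} else {})"
    by auto
  finally show ?thesis by simp
qed

text \<open>Pascal's rule; the summands sort the words by the letter read last, which is up, level
  or down.\<close>

lemma steps_Suc:
  assumes "e \<le> m"
  shows "steps (Suc m) e (Suc k) =
    (if e > 0 then steps m (e - 1) k else 0) + steps m e (Suc k) + steps m e (Suc (Suc k))"
proof (cases "Suc k \<le> e")
  case False
  then show ?thesis by (auto simp: steps_def)
next
  case True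
  then obtain i where i: "e = Suc (k + i)"
    by (metis add_Suc le_Suc_ex)
  have s: "Suc m - e = Suc (m - e)" using assms by simp
  have "(Suc m choose e) * (Suc m - e choose i) =
        (m choose (e - 1)) * (m - (e - 1) choose i) + (m choose e) * (Suc (m - e) choose i)"
    using i assms s by (simp add: add_mult_distrib Suc_diff_le)
  moreover have "Suc (m - e) choose i = (m - e choose i) + (if i = 0 then 0 else (m - e) choose (i - 1))"
    by (cases i) auto
  ultimately show ?thesis
    using i by (cases i) (auto simp: steps_def add_mult_distrib2)
qed

text \<open>Height 0 is entered from -1, 0 and 1. Exchanging up and down steps turns paths to -1
  into paths to 1, hence the factor 2.\<close>

lemma steps_Suc_0:
  assumes "e \<le> m"
  shows "steps (Suc m) e 0 = steps m e 0 + 2 * steps m e 1"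
proof (cases e)
  case 0
  then show ?thesis by (simp add: steps_def)
next
  case (Suc d)
  \<comment> \<open>\<open>d\<close> up and \<open>d + 1\<close> down steps lead to -1, the
    exchanged numbers to 1.\<close>
  have "(m choose d) * (m - d choose Suc d) = (m choose Suc d) * (m - Suc d choose d)"
  proof (cases "Suc d + d \<le> m")
    case True
    have "(m choose d) * (m - d choose Suc d) = (m choose (Suc d + d)) * (Suc d + d choose d)"
      using choose_mult[of d "Suc d + d" m] True by simp
    moreover have "(m choose Suc d) * (m - Suc d choose d) = (m choose (Suc d + d)) * (Suc d + d choose Suc d)"
      using choose_mult[of "Suc d" "Suc d + d" m] True by simp
    moreover have "Suc d + d choose d = Suc d + d choose Suc d"
      by (subst binomial_symmetric) auto
    ultimately show ?thesis by simp
  next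
    case False
    hence "m - d < Suc d" "m - Suc d < d \<or> m < Suc d" by auto
    thus ?thesis by (auto simp: binomial_eq_0)
  qed
  moreover have "Suc m - e = Suc (m - e)" using assms by simp
  moreover have "m - d = Suc (m - e)" using Suc assms by simp
  ultimately show ?thesis
    using Suc by (simp add: steps_def algebra_simps)
qed

lemma grand_poly_Suc:
  "grand_poly (Suc m) (Suc k) =
     grand_poly m k + pCons 0 (grand_poly m (Suc k) + grand_poly m (Suc (Suc k)))"
proof (rule poly_eqI)
  fix j
  show "coeff (grand_poly (Suc m) (Suc k)) j =
    coeff (grand_poly m k + pCons 0 (grand_poly m (Suc k) + grand_poly m (Suc (Suc k)))) j"
  proof (cases j)
    case 0
    then show ?thesis by (simp add: coeff_grand_poly steps_def)
  next
    case (Suc i)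
    then show ?thesis
      using steps_Suc[of "m - i" m k] by (auto simp: coeff_grand_poly)
  qed
qed

lemma grand_poly_Suc_0:
  "grand_poly (Suc m) 0 = pCons 0 (grand_poly m 0 + smult 2 (grand_poly m 1))"
proof (rule poly_eqI)
  fix j
  show "coeff (grand_poly (Suc m) 0) j = coeff (pCons 0 (grand_poly m 0 + smult 2 (grand_poly m 1))) j"
  proof (cases j)
    case 0
    then show ?thesis by (simp add: coeff_grand_poly steps_def)
  next
    case (Suc i)
    then show ?thesis
      using steps_Suc_0[of "m - i" m]
      by (auto simp: coeff_grand_poly)
  qed
qed

text \<open>The reflection principle: a path from height \<open>0\<close> to \<open>k\<close> that touches height \<open>-1\<close> becomes,
  after reflecting its initial part, a path from \<open>-2\<close> to \<open>k\<close> with one up step more.\<close>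

lemma motzkin_poly_eq: "motzkin_poly m k = grand_poly m k - pCons 0 (grand_poly m (k + 2))"
proof (induction m arbitrary: k)
  case 0
  have "grand_poly 0 k = (if k = 0 then 1 else 0)" for k
    by (auto simp: grand_poly_def steps_def one_pCons monom_0)
  then show ?case by (simp add: motzkin_poly_0)
next
  case (Suc m)
  show ?case
  proof (cases k)
    case 0
    have "pCons 0 (smult 2 p) = pCons 0 p + pCons 0 p" for p :: "int poly"
      by (simp add: poly_eq_iff coeff_pCons numeral_poly split: nat.split)
    with 0 show ?thesis
      by (simp add: motzkin_poly_Suc Suc grand_poly_Suc_0 grand_poly_Suc numeral_2_eq_2)
  next
    case (Suc l)
    then show ?thesis
      by (simp add: motzkin_poly_Suc Suc.IH grand_poly_Suc numeral_2_eq_2 algebra_simps)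
  qed
qed

text \<open>The two summands come from the two staircase partitions with \<open>k\<close> inner cuts; for \<open>k = 0\<close> one of
  them is the full square.\<close>

definition run_weight :: "nat \<Rightarrow> int poly" where
  "run_weight k = monom 1 ((k + 2) div 2) + (if k = 0 then 0 else monom 1 ((k + 1) div 2))"

text \<open>From k to k + 2 both exponents rise by one; only at k = 0 is the second summand missing,
  which leaves an extra q.\<close>

lemma run_weight_simps:
  "run_weight 0 = monom 1 1"
  "run_weight (Suc 0) = smult 2 (monom 1 1)"
  "run_weight (Suc (Suc k)) = pCons 0 (run_weight k) + (if k = 0 then monom 1 1 else 0)"
  by (auto simp: run_weight_def monom_Suc monom_0 numeral_poly)

text \<open>After shifting the index of the subtracted terms, the coefficient of \<open>N k\<close>
  is \<open>run_weight k\<close> minus q times \<open>run_weight (k - 2)\<close>, which vanishes for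
  k > 2. Only the heights 0, 1 and 2 survive.\<close>

lemma sum_motzkin_run_weight:
  "(\<Sum>k\<le>m. motzkin_poly m k * run_weight k) =
     pCons 0 (grand_poly m 0 + smult 2 (grand_poly m 1) + grand_poly m 2)"
proof -
  define N where "N = grand_poly m"
  have N0: "N k = 0" if "k > m" for k
    using that by (auto simp: N_def grand_poly_def steps_def)
  have "(\<Sum>k<K. (N k - pCons 0 (N (k + 2))) * run_weight k) =
      (\<Sum>k<K. N k * run_weight k) - (\<Sum>k<K + 2. if k \<ge> 2 then pCons 0 (N k) * run_weight (k - 2) else 0)" for K
    by (induction K) (simp_all add: algebra_simps)
  from this[of "Suc m"] have "(\<Sum>k\<le>m. motzkin_poly m k * run_weight k) =
      (\<Sum>k<Suc m. N k * run_weight k) - (\<Sum>k<Suc m + 2. if k \<ge> 2 then pCons 0 (N k) * run_weight (k - 2) else 0)"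
    by (simp add: motzkin_poly_eq N_def lessThan_Suc_atMost)
  \<comment> \<open>Heights above \<open>m\<close> contribute nothing, so both sums may run over the
    same range.\<close>
  also have "(\<Sum>k<Suc m. N k * run_weight k) = (\<Sum>k<Suc m + 2. N k * run_weight k)"
    by (rule sum.mono_neutral_left) (auto simp: N0)
  also have "(\<Sum>k<Suc m + 2. N k * run_weight k) - (\<Sum>k<Suc m + 2. if k \<ge> 2 then pCons 0 (N k) * run_weight (k - 2) else 0) =
      (\<Sum>k<Suc m + 2. N k * (if k = 0 then monom 1 1 else if k = 1 then smult 2 (monom 1 1) else if k = 2 then monom 1 1 else 0))"
  proof (subst sum_subtractf [symmetric], rule sum.cong)
    fix k
    show "N k * run_weight k - (if k \<ge> 2 then pCons 0 (N k) * run_weight (k - 2) else 0) =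
      N k * (if k = 0 then monom 1 1 else if k = 1 then smult 2 (monom 1 1) else if k = 2 then monom 1 1 else 0)"
    proof (cases "k \<ge> 2")
      case True
      then obtain l where "k = Suc (Suc l)"
        by (metis add_2_eq_Suc le_Suc_ex)
      thus ?thesis by (simp add: run_weight_simps algebra_simps)
    next
      case False
      hence "k = 0 \<or> k = Suc 0" by auto
      thus ?thesis by (auto simp: run_weight_simps)
    qed
  qed simp
  also have "\<dots> = (\<Sum>k\<in>{0,1,2}. N k * (if k = 0 then monom 1 1 else if k = 1 then smult 2 (monom 1 1) else if k = 2 then monom 1 1 else 0))"
    by (rule sum.mono_neutral_right) auto
  also have "\<dots> = pCons 0 (N 0 + smult 2 (N 1) + N 2)"
    by (simp add: monom_Suc monom_0 one_pCons[symmetric] algebra_simps)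
  finally show ?thesis by (simp add: N_def)
qed

lemma sum_motzkin_binomial:
  assumes "n \<ge> 1"
  shows "(\<Sum>k<n. motzkin_poly (n - 1) k * run_weight k) =
    Sum_any (\<lambda>k. monom (of_nat (((n - 1) choose k) * ((n - k + 1) choose k))) (n - k))"
proof -
  define m where "m = n - 1"
  have n: "n = Suc m" using assms by (simp add: m_def)
  \<comment> \<open>Pascal's rule twice in the second factor, with upper index \<open>m - e\<close>;
    note that \<open>m - e + 2\<close> is \<open>n - e + 1\<close>.\<close>
  have binom: "steps m e 0 + 2 * steps m e 1 + steps m e 2 = (m choose e) * (m - e + 2 choose e)" for e
  proof (cases "e \<ge> 2")
    case True
    then obtain i where "e = Suc (Suc i)" by (metis add_2_eq_Suc le_Suc_ex)
    thus ?thesis by (simp add: steps_def numeral_2_eq_2 algebra_simps)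
  next
    case False
    hence "e = 0 \<or> e = Suc 0" by auto
    thus ?thesis by (auto simp: steps_def)
  qed
  have "Sum_any (\<lambda>k. monom (of_nat (((n - 1) choose k) * ((n - k + 1) choose k))) (n - k)) =
     (\<Sum>k\<le>m. monom (int (((n - 1) choose k) * ((n - k + 1) choose k))) (n - k))"
  proof (rule Sum_any.expand_superset)
    show "{k. monom (int (((n - 1) choose k) * ((n - k + 1) choose k))) (n - k) \<noteq> 0} \<subseteq> {..m}"
      proof
      fix k assume "k \<in> {k. monom (int (((n - 1) choose k) * ((n - k + 1) choose k))) (n - k) \<noteq> 0}"
      hence "(m choose k) \<noteq> 0" by (auto simp: n)
      thus "k \<in> {..m}" by simp
    qed
  qed simp
  also have "\<dots> = (\<Sum>k\<le>m. pCons 0 (monom (int (steps m k 0 + 2 * steps m k 1 + steps m k 2)) (m - k)))"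
  proof (rule sum.cong)
    fix k assume "k \<in> {..m}"
    hence "n - k = Suc (m - k)" by (simp add: n Suc_diff_le)
    moreover from this have "n - k + 1 = m - k + 2" by simp
    moreover have "n - 1 = m" by (simp add: n)
    ultimately show "monom (int (((n - 1) choose k) * ((n - k + 1) choose k))) (n - k) =
        pCons 0 (monom (int (steps m k 0 + 2 * steps m k 1 + steps m k 2)) (m - k))"
      unfolding binom by (simp only: monom_Suc)
  qed simp
  also have "\<dots> = (\<Sum>k\<le>m. pCons 0 (monom (int (steps m k 0)) (m - k)) +
      smult 2 (pCons 0 (monom (int (steps m k 1)) (m - k))) + pCons 0 (monom (int (steps m k 2)) (m - k)))"
    by (rule sum.cong) (simp_all add: add_monom[symmetric] smult_monom)
  also have "\<dots> = pCons 0 (grand_poly m 0 + smult 2 (grand_poly m 1) + grand_poly m 2)"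
    by (simp add: poly_eq_iff grand_poly_def sum.distrib coeff_sum coeff_pCons sum_distrib_left split: nat.split)
  finally show ?thesis
    using sum_motzkin_run_weight[of m] by (simp add: n lessThan_Suc_atMost)
qed

section \<open>Bracket functions and their Pop operator\<close>

text \<open>The value \<open>f 0 = n\<close> is a sentinel: it makes \<open>0\<close> the root of the forest, and the conditions
  on last children then cover the last tree.\<close>

locale bracket =
  fixes n :: int and f :: "int \<Rightarrow> int"
  assumes n_pos: "1 \<le> n"
    and zero: "f 0 = n"
    and pos_ge: "\<And>i. 1 \<le> i \<Longrightarrow> i \<le> n \<Longrightarrow> i \<le> f i"
    and pos_le: "\<And>i. 1 \<le> i \<Longrightarrow> i \<le> n \<Longrightarrow> f i \<le> n"
    and neg_ge: "\<And>k. 1 \<le> k \<Longrightarrow> k \<le> n \<Longrightarrow> 0 \<le> f (- k)"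
    and neg_le: "\<And>k. 1 \<le> k \<Longrightarrow> k \<le> n \<Longrightarrow> f (- k) \<le> n"
    and sym: "\<And>k l. 1 \<le> k \<Longrightarrow> k \<le> n \<Longrightarrow> 1 \<le> l \<Longrightarrow> l \<le> n \<Longrightarrow> l \<le> f (- k) \<longleftrightarrow> k \<le> f (- l)"
    and laminar: "\<And>a j. a < j \<Longrightarrow> 0 < j \<Longrightarrow> j \<le> f a \<Longrightarrow> f j \<le> f a"
    and outside: "\<And>a. a < - n \<or> n < a \<Longrightarrow> f a = 0"

definition brackets :: "int \<Rightarrow> (int \<Rightarrow> int) set" where
  "brackets n = {f. bracket n f}"

text \<open>For a node \<open>a > 0\<close> with children this is the last child of \<open>a\<close>; for \<open>a < 0\<close> it is the root
  of the tree that ends at \<open>f a\<close>. The \<open>Min\<close> is taken over a nonempty set only if \<open>max a 0 < f a\<close>.\<close>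

definition next_end :: "int \<Rightarrow> (int \<Rightarrow> int) \<Rightarrow> int \<Rightarrow> int" where
  "next_end n f a = Min {y. max a 0 < y \<and> y \<le> n \<and> f y = f a}"

text \<open>A node \<open>a > 0\<close> loses its last child. A row \<open>- a\<close> of the
  partition is shortened only if it lies in the last tree among the rows of its length: the last of
  these rows is \<open>f (- f a)\<close>, and \<open>next_end n f (- f a)\<close> is the root of the
  tree ending there.\<close>

definition pop :: "int \<Rightarrow> (int \<Rightarrow> int) \<Rightarrow> int \<Rightarrow> int" where
  "pop n f a =
     (if 0 < a \<and> a < f a \<or> a < 0 \<and> 0 < f a \<and> next_end n f (- f a) \<le> - a
      then next_end n f a - 1 else f a)"

definition covers_in :: "'a :: order set \<Rightarrow> 'a \<Rightarrow> 'a \<Rightarrow> bool" where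
  "covers_in V y x \<longleftrightarrow> x \<in> V \<and> y \<in> V \<and> y < x \<and> \<not> (\<exists>z\<in>V. y < z \<and> z < x)"

lemma next_end_cong: "a \<le> 0 \<Longrightarrow> b \<le> 0 \<Longrightarrow> f a = f b \<Longrightarrow> next_end n f a = next_end n f b"
  by (simp add: next_end_def)

context bracket
begin

lemma le_n: "f a \<le> n"
proof (cases "a < - n \<or> n < a")
  case True
  with n_pos outside show ?thesis by auto
next
  case False
  with n_pos zero pos_le[of a] neg_le[of "- a"] show ?thesis
    by (cases "a = 0"; cases "0 < a") auto
qed

lemma nonneg: "0 \<le> f a"
proof (cases "a < - n \<or> n < a")
  case True
  with outside show ?thesis by auto
next
  case False
  with n_pos zero pos_ge[of a] neg_ge[of "- a"] show ?thesis
    by (cases "a = 0"; cases "0 < a") auto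
qed

lemma ge_self: "0 < f a \<Longrightarrow> a \<le> f a"
  using pos_ge[of a] outside[of a] by (cases "0 < a"; cases "a \<le> n") auto

lemma in_range: "0 < f a \<Longrightarrow> - n \<le> a \<and> a \<le> n"
  using outside[of a] by (metis less_irrefl not_le)

lemma idem: "0 < f a \<Longrightarrow> f (f a) = f a"
  using ge_self[of a] laminar[of a "f a"] pos_ge[of "f a"] le_n[of a]
  by (cases "a = f a") auto

lemma neg_antimono:
  assumes "1 \<le> k" "k \<le> k'" "k' \<le> n"
  shows "f (- k') \<le> f (- k)"
proof (cases "f (- k') = 0")
  case False
  hence "1 \<le> f (- k')" using nonneg[of "- k'"] by simp
  with assms sym[of k' "f (- k')"] sym[of k "f (- k')"] le_n[of "- k'"] show ?thesis by auto
qed (use nonneg in auto)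

text \<open>The last clause is the forest property: a tree rooted strictly between \<open>a\<close>
  and \<open>next_end n f a\<close> that reached this root would swallow its whole tree and so end
  at \<open>f a\<close>, against minimality.\<close>

lemma next_end:
  assumes "max a 0 < f a"
  shows "max a 0 < next_end n f a" "next_end n f a \<le> f a" "f (next_end n f a) = f a"
    "\<And>z. a < z \<Longrightarrow> 0 < z \<Longrightarrow> z < next_end n f a \<Longrightarrow> f z < next_end n f a"
proof -
  let ?S = "{y. max a 0 < y \<and> y \<le> n \<and> f y = f a}"
  have fin: "finite ?S"
    by (rule finite_subset[of _ "{0..n}"]) auto
  have mem: "f a \<in> ?S" using assms idem[of a] le_n[of a] by auto
  have "Min ?S \<in> ?S" using fin mem by (intro Min_in) auto
  thus 1: "max a 0 < next_end n f a" "f (next_end n f a) = f a"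
    by (simp_all add: next_end_def)
  show 2: "next_end n f a \<le> f a"
    unfolding next_end_def using fin mem by (rule Min_le)
  fix z assume z: "a < z" "0 < z" "z < next_end n f a"
  have "f z \<le> f a" using z 2 by (intro laminar) auto
  moreover have "f z \<noteq> f a"
  proof
    assume "f z = f a"
    with z 2 le_n[of a] have "z \<in> ?S" by auto
    with fin have "Min ?S \<le> z" by (rule Min_le)
    with z show False by (simp add: next_end_def)
  qed
  ultimately show "f z < next_end n f a"
    using laminar[of z "next_end n f a"] 1 z by force
qed

text \<open>By conjugation \<open>f (- l)\<close> counts the rows of length at least
  \<open>l\<close>. For \<open>l = f (- k)\<close> it is the last row as long as row
  \<open>k\<close>, so \<open>(f (- l), l)\<close> is a corner of the diagram.\<close>

lemma corner:
  assumes "1 \<le> k" "k \<le> n" "0 < f (- k)"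
  shows "k \<le> f (- f (- k))" "f (- f (- f (- k))) = f (- k)"
proof -
  let ?l = "f (- k)"
  have l: "1 \<le> ?l" "?l \<le> n" using assms le_n[of "- k"] by auto
  show k: "k \<le> f (- ?l)" using sym[of k ?l] assms l by simp
  show "f (- f (- ?l)) = ?l"
    using sym[of "f (- ?l)" ?l] neg_antimono[of k "f (- ?l)"] k assms l le_n[of "- ?l"] by auto
qed

text \<open>A row below the corner that reached a column of the last tree would, by laminarity,
  contain the whole tree and with it column \<open>f (- k)\<close>. So all columns of that tree have
  the same height.\<close>

lemma corner_block:
  assumes k: "1 \<le> k" "k \<le> n" and d: "next_end n f (- k) \<le> d" "d \<le> f (- k)" and pos: "0 < f (- k)"
  shows "f (- d) = f (- f (- k))"
proof -
  let ?l = "f (- k)" and ?c = "f (- f (- k))"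
  have ne: "max (- k) 0 < f (- k)" using k pos by simp
  note N = next_end[OF ne]
  have l: "1 \<le> ?l" "?l \<le> n" using pos le_n[of "- k"] by auto
  have d1: "1 \<le> d" "d \<le> n" using N d l by auto
  have c: "k \<le> ?c" "?c \<le> n" using corner(1)[OF k pos] le_n by auto
  have "?c \<le> f (- d)"
    using neg_antimono[of d ?l] d d1 l by simp
  moreover have "f (- d) \<le> ?c"
  proof (rule ccontr)
    assume "\<not> f (- d) \<le> ?c"
    hence less: "?c < f (- d)" by simp
    have "d \<le> f (- (?c + 1))"
      using sym[of d "?c + 1"] less d1 k c le_n[of "- d"] by simp
    hence "next_end n f (- k) \<le> f (- (?c + 1))" using d by simp
    hence "?l \<le> f (- (?c + 1))"
      using laminar[of "- (?c + 1)" "next_end n f (- k)"] N k c by auto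
    hence "?c + 1 \<le> ?c"
      using sym[of "?c + 1" ?l] l k c less le_n[of "- d"] by simp
    thus False by simp
  qed
  ultimately show ?thesis by simp
qed

lemma pop_le: "pop n f a \<le> f a"
  using next_end(2)[of a] by (auto simp: pop_def)

lemma pop_nonneg: "0 \<le> pop n f a"
  using next_end(1)[of a] nonneg[of a] by (auto simp: pop_def)

lemma pop_pos_ge: "1 \<le> i \<Longrightarrow> i \<le> n \<Longrightarrow> i \<le> pop n f i"
  using next_end(1)[of i] pos_ge[of i] by (auto simp: pop_def)

lemma pop_cell_iff:
  assumes "1 \<le> k" "1 \<le> d"
  shows "d \<le> pop n f (- k) \<longleftrightarrow>
    d \<le> f (- k) \<and> \<not> (next_end n f (- f (- k)) \<le> k \<and> next_end n f (- k) \<le> d)"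
  using assms next_end(2)[of "- k"] by (auto simp: pop_def)

text \<open>Common source of \<open>bracket_pop\<close> and of both kinds of lower covers:
  \<open>pop\<close> may be applied to part of the arguments. The hypothesis on \<open>P\<close>
  lowers, along with a row, the rows of the mirror image of its corner; this keeps the partition
  self-conjugate.\<close>

lemma bracket_partial_pop:
  assumes P: "\<And>k d. 1 \<le> k \<Longrightarrow> k \<le> n \<Longrightarrow> 1 \<le> d \<Longrightarrow> d \<le> n \<Longrightarrow> 0 < f (- k) \<Longrightarrow>
    f (- d) = f (- f (- k)) \<Longrightarrow> P (- k) \<Longrightarrow> P (- d)"
  shows "bracket n (\<lambda>a. if P a then pop n f a else f a)" (is "bracket n ?g")
proof
  have g_le: "?g a \<le> f a" for a using pop_le by simp
  \<comment> \<open>If the cell \<open>(d, k)\<close> is lost in row \<open>d\<close>, then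
    \<open>k\<close> lies in the last tree of that row. \<open>corner_block\<close> makes
    \<open>k\<close> a row of the mirrored corner, so \<open>(k, d)\<close> is lost as well.\<close>
  have cell: "k \<le> ?g (- d)"
    if kd: "1 \<le> k" "k \<le> n" "1 \<le> d" "d \<le> n" and le: "d \<le> ?g (- k)" for k d
  proof (rule ccontr)
    assume not: "\<not> k \<le> ?g (- d)"
    have "d \<le> f (- k)" using le g_le[of "- k"] by simp
    hence kf: "k \<le> f (- d)" using sym[of k d] kd by simp
    with not have Pd: "P (- d)" and npop: "\<not> k \<le> pop n f (- d)" by (auto split: if_splits)
    hence rem: "next_end n f (- f (- d)) \<le> d" "next_end n f (- d) \<le> k"
      using pop_cell_iff[of d k] kd kf by auto
    have fd: "0 < f (- d)" using kf kd by simp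
    have fk: "f (- k) = f (- f (- d))"
      using corner_block[of d k] kd rem kf fd by simp
    have ffk: "f (- f (- k)) = f (- d)" using corner(2)[of d] kd fd fk by simp
    have "P (- k)" using P[of d k] kd fd fk Pd by simp
    hence "d \<le> pop n f (- k)" using le by simp
    moreover have "next_end n f (- f (- k)) = next_end n f (- d)" using ffk kd nonneg[of "- k"]
      by (intro next_end_cong) auto
    moreover have "next_end n f (- k) = next_end n f (- f (- d))" using fk kd nonneg[of "- d"]
      by (intro next_end_cong) auto
    ultimately show False
      using pop_cell_iff[of k d] kd rem by simp
  qed
  show "1 \<le> n" by (rule n_pos)
  show "?g 0 = n" by (simp add: pop_def zero)
  show "i \<le> ?g i" if "1 \<le> i" "i \<le> n" for i using that pos_ge pop_pos_ge by simp
  show "?g i \<le> n" for i using g_le[of i] le_n[of i] by linarith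
  then show "?g (- k) \<le> n" for k by blast
  show "0 \<le> ?g (- k)" for k using nonneg pop_nonneg by simp
  show "l \<le> ?g (- k) \<longleftrightarrow> k \<le> ?g (- l)" if "1 \<le> k" "k \<le> n" "1 \<le> l" "l \<le> n" for k l
    using cell[of k l] cell[of l k] that by blast
  show "?g a = 0" if "a < - n \<or> n < a" for a
    using outside[OF that] n_pos that by (auto simp: pop_def)
  show "?g j \<le> ?g a" if j: "a < j" "0 < j" "j \<le> ?g a" for a j
  proof (cases "?g a = f a")
    case True
    have "?g j \<le> f j" by (rule g_le)
    also have "\<dots> \<le> f a" using laminar j True by simp
    finally show ?thesis using True by simp
  next
    case False
    hence "?g a = next_end n f a - 1" and "max a 0 < f a"
      by (auto simp: pop_def split: if_splits)
    thus ?thesis using next_end(4)[of a j] j g_le[of j] by auto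
  qed
qed

lemma bracket_pop: "bracket n (pop n f)"
  using bracket_partial_pop[of "\<lambda>_. True"] by simp

text \<open>Lowering a value cannot stop halfway: once \<open>g a\<close> reaches the root of the
  last tree, laminarity makes it swallow that tree up to \<open>f a\<close>, provided the root kept
  its end.\<close>

lemma ge_f_of_ge_next_end:
  assumes g: "bracket n g" "g \<le> f" and a: "max a 0 < f a"
    and fixed: "g (next_end n f a) = f (next_end n f a)" and ge: "next_end n f a \<le> g a"
  shows "g a = f a"
proof -
  interpret g: bracket n g by (rule g)
  have "g (next_end n f a) \<le> g a"
    using g.laminar next_end(1)[OF a] ge by auto
  moreover have "g a \<le> f a" using g(2) by (simp add: le_fun_def)
  ultimately show ?thesis using fixed next_end(3)[OF a] by simp
qed

section \<open>Lower covers of a bracket function and their meet\<close>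

definition lower_pos :: "int \<Rightarrow> int \<Rightarrow> int" where
  "lower_pos i = f(i := pop n f i)"

text \<open>The two equations select the rows as long as row \<open>k\<close> and the rows of the
  mirrored corner; among them \<open>pop\<close> changes only those of the last tree. The effect is
  the removal of one corner rectangle and its mirror image.\<close>

definition lower_neg :: "int \<Rightarrow> int \<Rightarrow> int" where
  "lower_neg k a = (if a < 0 \<and> (f a = f (- k) \<or> f a = f (- f (- k))) then pop n f a else f a)"

lemma pop_le_lower_pos: "pop n f \<le> lower_pos i"
  using pop_le by (auto simp: le_fun_def lower_pos_def)

lemma pop_le_lower_neg: "pop n f \<le> lower_neg k"
  using pop_le by (auto simp: le_fun_def lower_neg_def)

lemma covers_lower_pos:
  assumes i: "0 < i" "i < f i"
  shows "covers_in (brackets n) (lower_pos i) f"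
proof -
  have eq: "lower_pos i = (\<lambda>a. if a = i then pop n f a else f a)"
    by (auto simp: lower_pos_def)
  have "bracket n (lower_pos i)"
    unfolding eq by (rule bracket_partial_pop) (use i in auto)
  moreover have p: "pop n f i = next_end n f i - 1"
    using i by (simp add: pop_def)
  have ne: "max i 0 < f i" using i by simp
  note N = next_end[OF ne]
  have lt: "pop n f i < f i" using p N by simp
  hence "lower_pos i < f"
    by (auto simp: less_fun_def le_fun_def lower_pos_def not_le)
  moreover have "g = f" if g: "bracket n g" "lower_pos i < g" "g \<le> f" for g
  proof -
    have eq: "g a = f a" if "a \<noteq> i" for a
    proof (rule antisym)
      show "g a \<le> f a" using g by (simp add: le_fun_def)
      show "f a \<le> g a"
        using g(2) that by (auto simp: less_fun_def le_fun_def lower_pos_def dest!: spec[of _ a])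
    qed
    have "\<not> g \<le> lower_pos i" using g(2) by simp
    then obtain a where "lower_pos i a < g a" by (auto simp: le_fun_def not_le)
    with eq[of a] have "pop n f i < g i" by (auto simp: lower_pos_def split: if_splits)
    hence "next_end n f i \<le> g i" using p by simp
    moreover have "g (next_end n f i) = f (next_end n f i)" using N(1) by (intro eq) simp
    ultimately have "g i = f i" using ge_f_of_ge_next_end[OF g(1,3) ne] by simp
    thus ?thesis using eq by (metis ext)
  qed
  ultimately show ?thesis
    unfolding covers_in_def brackets_def
    using bracket_axioms by (auto simp: less_le)
qed

lemma pop_neg_less:
  assumes "a < 0" "pop n f a < f a"
  shows "0 < f a" "next_end n f (- f a) \<le> - a" "pop n f a = next_end n f a - 1"
  using assms by (auto simp: pop_def split: if_splits)

text \<open>One surviving cell of the rectangle that \<open>pop\<close> removes forces the corner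
  cell: laminarity completes the row, symmetry passes to the last column, and laminarity completes
  that column.\<close>

lemma neg_eq_corner:
  assumes g: "bracket n g" "g \<le> f" "\<And>i. 0 < i \<Longrightarrow> g i = f i"
    and k: "1 \<le> k" "k \<le> n" "pop n f (- k) < g (- k)"
    and less: "pop n f (- k) < f (- k)"
  shows "f (- k) \<le> g (- f (- f (- k)))"
proof -
  interpret g: bracket n g by (rule g)
  let ?l = "f (- k)"
  have k': "0 < ?l" "next_end n f (- ?l) \<le> k" "pop n f (- k) = next_end n f (- k) - 1"
    using pop_neg_less[of "- k"] k less by auto
  have l: "1 \<le> ?l" "?l \<le> n" using k' le_n[of "- k"] by auto
  have c: "k \<le> f (- ?l)" "f (- f (- ?l)) = ?l" using corner[of k] k k' by auto
  have c': "1 \<le> f (- ?l)" "f (- ?l) \<le> n" using c k le_n by auto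
  have "g (- k) = ?l"
  proof (rule ge_f_of_ge_next_end[OF g(1,2)])
    show "max (- k) 0 < ?l" using k l by simp
    thus "g (next_end n f (- k)) = f (next_end n f (- k))"
      using next_end(1)[of "- k"] by (intro g) simp
    show "next_end n f (- k) \<le> g (- k)" using k k' by simp
  qed
  hence "k \<le> g (- ?l)" using g.sym[of k ?l] k l by simp
  have "g (- ?l) = f (- ?l)"
  proof (rule ge_f_of_ge_next_end[OF g(1,2)])
    show "max (- ?l) 0 < f (- ?l)" using l c' by simp
    thus "g (next_end n f (- ?l)) = f (next_end n f (- ?l))"
      using next_end(1)[of "- ?l"] by (intro g) simp
    show "next_end n f (- ?l) \<le> g (- ?l)" using \<open>k \<le> g (- ?l)\<close> k' by simp
  qed
  thus ?thesis using g.sym[of "f (- ?l)" ?l] c' l by simp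
qed

text \<open>Any \<open>g\<close> strictly above \<open>lower_neg k\<close> keeps a cell of the
  rectangle or of its mirror image, hence the corner cell by \<open>neg_eq_corner\<close>; by
  monotonicity of the rows it then keeps everything.\<close>

lemma covers_lower_neg:
  assumes k: "1 \<le> k" "k \<le> n" "pop n f (- k) < f (- k)"
  shows "covers_in (brackets n) (lower_neg k) f"
proof -
  let ?l = "f (- k)"
  have l: "1 \<le> ?l" "?l \<le> n" using k pop_neg_less[of "- k"] le_n by auto
  have c: "k \<le> f (- ?l)" "f (- f (- ?l)) = ?l" using corner[of k] k l by auto
  have c': "1 \<le> f (- ?l)" "f (- ?l) \<le> n" using c k le_n by auto
  have eq: "lower_neg k = (\<lambda>a. if a < 0 \<and> (f a = ?l \<or> f a = f (- ?l)) then pop n f a else f a)"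
    by (auto simp: lower_neg_def)
  have "bracket n (lower_neg k)"
    unfolding eq by (rule bracket_partial_pop) (use c in auto)
  moreover have "lower_neg k < f"
  proof -
    have "lower_neg k \<le> f" using pop_le by (auto simp: le_fun_def lower_neg_def)
    moreover have "lower_neg k (- k) < f (- k)" using k by (simp add: lower_neg_def)
    ultimately show ?thesis by (auto simp: less_fun_def le_fun_def not_le)
  qed
  moreover have "g = f" if g: "bracket n g" "lower_neg k < g" "g \<le> f" for g
  proof -
    interpret g: bracket n g by (rule g)
    have ge: "lower_neg k a \<le> g a" and le: "g a \<le> f a" for a
      using g by (auto simp: less_fun_def le_fun_def)
    have eq: "g a = f a" if "a \<ge> 0 \<or> (f a \<noteq> ?l \<and> f a \<noteq> f (- ?l))" for a
      using that ge[of a] le[of a] by (auto simp: lower_neg_def)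
    have "\<not> g \<le> lower_neg k" using g(2) by simp
    then obtain a where a: "lower_neg k a < g a" by (auto simp: le_fun_def not_le)
    have a0: "a < 0" and fa: "f a = ?l \<or> f a = f (- ?l)" and pa: "pop n f a < g a"
      using a le[of a] by (auto simp: lower_neg_def split: if_splits)
    have fa0: "0 < f a" using fa l c' by auto
    have "- n \<le> a" using outside[of a] fa0 by force
    have "f a \<le> g (- f (- f a))"
      using neg_eq_corner[of g "- a"] g eq a0 \<open>- n \<le> a\<close> pa le[of a] by auto
    hence cell: "?l \<le> g (- f (- ?l))"
      using fa c g.sym[of ?l "f (- ?l)"] l c' by auto
    hence cell': "f (- ?l) \<le> g (- ?l)" using g.sym[of ?l "f (- ?l)"] l c' by auto
    have "g b = f b" for b
    proof (cases "b \<ge> 0 \<or> (f b \<noteq> ?l \<and> f b \<noteq> f (- ?l))")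
      case True
      thus ?thesis by (rule eq)
    next
      case False
      hence b: "b < 0" "f b = ?l \<or> f b = f (- ?l)" by auto
      have fb: "1 \<le> f b" using b l c' by auto
      have bn: "- n \<le> b" using outside[of b] fb by force
      have "- b \<le> f (- f b)" using corner(1)[of "- b"] b bn fb by simp
      have "f b \<le> g b"
      proof (cases "f b = ?l")
        case True
        have "g (- f (- ?l)) \<le> g (- (- b))"
          using \<open>- b \<le> f (- f b)\<close> b True c' by (intro g.neg_antimono) auto
        thus ?thesis using cell True by simp
      next
        case False
        hence fb: "f b = f (- ?l)" using b by simp
        have "g (- ?l) \<le> g (- (- b))"
          using \<open>- b \<le> f (- f b)\<close> b fb l c by (intro g.neg_antimono) auto
        thus ?thesis using cell' fb by simp
      qed
      thus ?thesis using le[of b] by simp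
    qed
    thus ?thesis by auto
  qed
  ultimately show ?thesis
    unfolding covers_in_def brackets_def
    using bracket_axioms by (auto simp: less_le)
qed

text \<open>If the forests differ, the last node where they differ is taken: beyond it
  \<open>g\<close> agrees with \<open>f\<close>, so \<open>ge_f_of_ge_next_end\<close> applies. If
  they agree, some row got shorter, its corner is lost, and then no cell of the corner rectangle can
  be left.\<close>

lemma below_lower:
  assumes g: "bracket n g" "g < f"
  shows "(\<exists>i>0. i < f i \<and> g \<le> lower_pos i) \<or>
    (\<exists>k. 1 \<le> k \<and> k \<le> n \<and> pop n f (- k) < f (- k) \<and> g \<le> lower_neg k)"
proof -
  interpret g: bracket n g by (rule g)
  have le: "g a \<le> f a" for a using g by (auto simp: less_fun_def le_fun_def)
  have range: "- n \<le> a \<and> a \<le> n" if "g a < f a" for a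
    using that outside[of a] g.outside[of a] by force
  show ?thesis
  proof (cases "\<exists>i>0. g i < f i")
    case True
    define A where "A = {i. 0 < i \<and> g i < f i}"
    have "finite A"
      by (rule finite_subset[of _ "{0..n}"]) (use range in \<open>auto simp: A_def\<close>)
    moreover have "A \<noteq> {}" using True by (auto simp: A_def)
    ultimately have m: "Max A \<in> A" and max: "\<And>j. j \<in> A \<Longrightarrow> j \<le> Max A" by auto
    define i where "i = Max A"
    have i: "0 < i" "g i < f i" using m by (auto simp: A_def i_def)
    have eq: "g j = f j" if "i < j" for j
      using max[of j] le[of j] that i by (force simp: A_def i_def)
    have lt: "i < f i" using i range[of i] g.pos_ge[of i] by simp
    have "g i \<le> pop n f i"
    proof (rule ccontr)
      assume "\<not> g i \<le> pop n f i"
      hence "next_end n f i \<le> g i" using i lt by (simp add: pop_def)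
      moreover have ne: "max i 0 < f i" using lt i by simp
      moreover have "g (next_end n f i) = f (next_end n f i)"
        using next_end(1)[OF ne] by (intro eq) simp
      moreover have "g \<le> f" using g by simp
      ultimately have "g i = f i" using ge_f_of_ge_next_end[OF g(1)] by blast
      with i show False by simp
    qed
    hence "g \<le> lower_pos i" using le by (auto simp: le_fun_def lower_pos_def)
    with i lt show ?thesis by blast
  next
    case False
    hence pos: "g i = f i" if "0 < i" for i using that le[of i] by force
    have "\<not> f \<le> g" using g by auto
    then obtain a where a: "g a < f a" by (auto simp: le_fun_def not_le)
    hence a0: "a < 0" using pos[of a] zero g.zero by (cases "0 < a"; cases "a = 0") auto
    \<comment> \<open>The last row as long as row \<open>- a\<close>, so that
      \<open>(k, f a)\<close> is the corner cell that \<open>g\<close> lacks.\<close>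
    define k where "k = f (- f a)"
    have fa: "0 < f a" using a g.nonneg[of a] by simp
    have an: "- n \<le> a" using range a by simp
    have fa': "1 \<le> f a" "f a \<le> n" using fa le_n by auto
    have c: "- a \<le> k" "f (- k) = f a" using corner[of "- a"] a0 an fa by (auto simp: k_def)
    have k: "1 \<le> k" "k \<le> n" using c a0 le_n by (auto simp: k_def)
    have ck: "f (- f (- k)) = k" using c by (simp add: k_def)
    have "next_end n f (- f a) \<le> k"
      using next_end(2)[of "- f a"] k fa by (auto simp: k_def)
    hence pk: "pop n f (- k) < f (- k)"
      using next_end(2)[of "- k"] k fa c by (simp add: pop_def)
    have gk: "g (- k) < f a"
    proof (rule ccontr)
      assume "\<not> g (- k) < f a"
      moreover have "g (- k) \<le> g (- (- a))" using c k a0 by (intro g.neg_antimono) auto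
      ultimately show False using a by simp
    qed
    have gfa: "g (- f a) < k"
    proof (rule ccontr)
      assume "\<not> g (- f a) < k"
      hence "f a \<le> g (- k)" using g.sym[of k "f a"] k fa' by simp
      thus False using gk by simp
    qed
    have "g \<le> lower_neg k"
      unfolding le_fun_def
    proof
      fix b
      show "g b \<le> lower_neg k b"
      proof (cases "b < 0 \<and> (f b = f a \<or> f b = k) \<and> pop n f b < f b")
        case False
        thus ?thesis using le[of b] pop_le[of b] by (auto simp: lower_neg_def c k_def[symmetric])
      next
        case True
        hence b: "b < 0" "f b = f a \<or> f b = k" "pop n f b < f b" by auto
        have "f b \<noteq> 0" using b fa' k by auto
        hence bn: "- n \<le> b" using outside[of b] by force
        have "g b \<le> pop n f b"
        proof (rule ccontr)
          assume "\<not> g b \<le> pop n f b"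
          hence ge: "f b \<le> g (- f (- f b))"
            using neg_eq_corner[of g "- b"] g pos b bn by auto
          from b(2) show False
          proof
            assume "f b = f a"
            with ge have "f a \<le> g (- k)" by (simp add: k_def)
            with gk show False by simp
          next
            assume fb: "f b = k"
            hence "f (- f b) = f a" using c by simp
            with ge fb have "k \<le> g (- f a)" by simp
            with gfa show False by simp
          qed
        qed
        thus ?thesis using b by (simp add: lower_neg_def c k_def[symmetric])
      qed
    qed
    with k pk show ?thesis by blast
  qed
qed

text \<open>\<open>below_lower\<close> puts every lower cover below some \<open>lower_pos\<close> or
  \<open>lower_neg\<close>, and being a cover forces equality. So these are all the lower covers,
  and each of them dominates \<open>pop n f\<close>.\<close>

lemma pop_le_lower_cover: "covers_in (brackets n) g f \<Longrightarrow> pop n f \<le> g"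
proof -
  assume g: "covers_in (brackets n) g f"
  hence b: "bracket n g" "g < f" by (auto simp: covers_in_def brackets_def)
  have "g = h" if h: "covers_in (brackets n) h f" "g \<le> h" for h
    using g h unfolding covers_in_def by (metis order_le_less)
  with below_lower[OF b] covers_lower_pos covers_lower_neg pop_le_lower_pos pop_le_lower_neg
  show ?thesis by metis
qed

text \<open>Every value that \<open>pop\<close> changes is changed in the same way by one of the
  lower covers.\<close>

lemma lower_bound_le_pop:
  assumes "g \<le> f" "\<And>h. covers_in (brackets n) h f \<Longrightarrow> g \<le> h"
  shows "g \<le> pop n f"
  unfolding le_fun_def
proof
  fix a
  show "g a \<le> pop n f a"
  proof (cases "pop n f a < f a")
    case False
    thus ?thesis using assms(1) pop_le[of a] by (auto simp: le_fun_def dest!: spec[of _ a])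
  next
    case True
    show ?thesis
    proof (cases "0 < a")
      case pos: True
      with True have "a < f a" by (auto simp: pop_def split: if_splits)
      from assms(2)[OF covers_lower_pos[OF pos this]]
      have "g a \<le> lower_pos a a" by (simp add: le_fun_def)
      thus ?thesis by (simp add: lower_pos_def)
    next
      case False
      hence a: "a < 0" using True by (auto simp: pop_def split: if_splits)
      hence "0 < f a" using pop_neg_less[of a] True by simp
      hence "- n \<le> a" using outside[of a] by force
      hence "g \<le> lower_neg (- a)"
        using a True by (intro assms covers_lower_neg) auto
      hence "g a \<le> lower_neg (- a) a" by (simp add: le_fun_def)
      thus ?thesis using a by (simp add: lower_neg_def)
    qed
  qed
qed

end

section \<open>Signed permutations as bracket functions\<close>

text \<open>\<open>Pop\<close> is a Hilbert choice among greatest lower bounds. The hypotheses on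
  \<open>p\<close> exhibit \<open>p v\<close> as the meet of \<open>v\<close> and its lower covers,
  and antisymmetry of the order on \<open>V\<close> forces the choice to be the preimage of
  it.\<close>

lemma Pop_poly_order_iso:
  fixes L :: "'a gorder" and V :: "'b :: order set"
  assumes eq: "eq L = (=)"
    and bij: "bij_betw \<phi> (carrier L) V"
    and le: "\<And>x y. x \<in> carrier L \<Longrightarrow> y \<in> carrier L \<Longrightarrow> x \<sqsubseteq>\<^bsub>L\<^esub> y \<longleftrightarrow> \<phi> x \<le> \<phi> y"
    and p: "\<And>v. v \<in> V \<Longrightarrow> p v \<in> V" "\<And>v. v \<in> V \<Longrightarrow> p v \<le> v"
      "\<And>v h. covers_in V h v \<Longrightarrow> p v \<le> h"
      "\<And>v g. v \<in> V \<Longrightarrow> g \<in> V \<Longrightarrow> g \<le> v \<Longrightarrow> (\<And>h. covers_in V h v \<Longrightarrow> g \<le> h) \<Longrightarrow> g \<le> p v"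
  shows "Pop_poly L = (\<Sum>b\<in>p ` V. monom 1 (card {g. covers_in V b g}))"
proof -
  have V: "V = \<phi> ` carrier L" using bij by (simp add: bij_betw_def)
  have inj: "inj_on \<phi> (carrier L)" using bij by (simp add: bij_betw_def)
  have less: "x \<sqsubset>\<^bsub>L\<^esub> y \<longleftrightarrow> \<phi> x < \<phi> y" if "x \<in> carrier L" "y \<in> carrier L" for x y
    using le[OF that] inj_onD[OF inj _ that] by (auto simp: lless_def eq order_le_less)
  have cov: "covered_by L y x \<longleftrightarrow> x \<in> carrier L \<and> y \<in> carrier L \<and> covers_in V (\<phi> y) (\<phi> x)" for x y
    by (auto simp: covered_by_def covers_in_def V less)
  have Pop: "Pop L x \<in> carrier L \<and> \<phi> (Pop L x) = p (\<phi> x)" if x: "x \<in> carrier L" for x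
  proof -
    let ?A = "insert x {y. covered_by L y x}"
    have Lower: "l \<in> Lower L ?A \<longleftrightarrow> l \<in> carrier L \<and> \<phi> l \<le> \<phi> x \<and> (\<forall>h. covers_in V h (\<phi> x) \<longrightarrow> \<phi> l \<le> h)" for l
    proof
      assume l: "l \<in> Lower L ?A"
      have "\<phi> l \<le> h" if h: "covers_in V h (\<phi> x)" for h
      proof -
        obtain y where y: "y \<in> carrier L" "h = \<phi> y" using h by (auto simp: covers_in_def V)
        hence "y \<in> ?A" using h x cov by simp
        thus ?thesis using l y le by (auto simp: Lower_def)
      qed
      thus "l \<in> carrier L \<and> \<phi> l \<le> \<phi> x \<and> (\<forall>h. covers_in V h (\<phi> x) \<longrightarrow> \<phi> l \<le> h)"
        using l x le by (auto simp: Lower_def)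
    qed (use x in \<open>auto simp: Lower_def cov le\<close>)
    have vx: "\<phi> x \<in> V" using x V by simp
    obtain m where m: "m \<in> carrier L" "\<phi> m = p (\<phi> x)" using p(1)[OF vx] V by auto
    have "greatest L m (Lower L ?A)"
      unfolding greatest_def
    proof (intro conjI ballI)
      show "Lower L ?A \<subseteq> carrier L" by (auto simp: Lower_def)
      show "m \<in> Lower L ?A" using Lower m p(2)[OF vx] p(3) by simp
      fix l assume "l \<in> Lower L ?A"
      thus "l \<sqsubseteq>\<^bsub>L\<^esub> m" using Lower m le p(4)[OF vx, of "\<phi> l"] V by auto
    qed
    hence "greatest L (Pop L x) (Lower L ?A)"
      unfolding Pop_def inf_def by (rule someI)
    with \<open>greatest L m (Lower L ?A)\<close> have "\<phi> (Pop L x) = \<phi> m" "Pop L x \<in> carrier L"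
      using le by (auto simp: greatest_def Lower_def intro!: antisym)
    thus ?thesis using m by simp
  qed
  have upper: "card (upper_covers L b) = card {g. covers_in V (\<phi> b) g}" if b: "b \<in> carrier L" for b
  proof -
    have "{g. covers_in V (\<phi> b) g} = \<phi> ` upper_covers L b"
      using b by (auto simp: upper_covers_def cov covers_in_def V)
    moreover have "inj_on \<phi> (upper_covers L b)"
      using inj by (rule inj_on_subset) (auto simp: upper_covers_def cov)
    ultimately show ?thesis by (simp add: card_image)
  qed
  have img: "p ` V = \<phi> ` (Pop L ` carrier L)"
    unfolding V image_image using Pop by (intro image_cong) auto
  have "inj_on \<phi> (Pop L ` carrier L)"
    using inj by (rule inj_on_subset) (use Pop in auto)
  hence "(\<Sum>b\<in>p ` V. monom (1 :: int) (card {g. covers_in V b g})) =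
      (\<Sum>b\<in>Pop L ` carrier L. monom 1 (card {g. covers_in V (\<phi> b) g}))"
    unfolding img by (simp add: sum.reindex)
  also have "\<dots> = Pop_poly L"
    unfolding Pop_poly_def using upper Pop by (intro sum.cong) auto
  finally show ?thesis by simp
qed

section \<open>Signed values and their positions in a word\<close>

definition signed :: "nat \<Rightarrow> int set" where
  "signed n = {- int n..int n} - {0}"

text \<open>The signed value \<open>i > 0\<close> stands for \<open>n + i\<close> and \<open>-i\<close> for \<open>n + 1 - i\<close>, so that the symmetry
  \<open>v \<mapsto> 2n + 1 - v\<close> is negation.\<close>

definition val :: "nat \<Rightarrow> int \<Rightarrow> nat" where
  "val n a = nat (int n + a + (if 0 < a then 0 else 1))"

lemma int_val: "a \<in> signed n \<Longrightarrow> int (val n a) = int n + a + (if 0 < a then 0 else 1)"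
  by (auto simp: val_def signed_def)

lemma val_less_iff: "a \<in> signed n \<Longrightarrow> c \<in> signed n \<Longrightarrow> val n a < val n c \<longleftrightarrow> a < c"
  unfolding of_nat_less_iff[where 'a = int, symmetric] by (auto simp: int_val signed_def)

lemma inj_on_val: "inj_on (val n) (signed n)"
  by (rule inj_onI) (metis val_less_iff less_irrefl linorder_neqE)

lemma val_image: "val n ` signed n = {1..2 * n}"
proof
  show "val n ` signed n \<subseteq> {1..2 * n}"
  proof (rule image_subsetI)
    fix a assume a: "a \<in> signed n"
    show "val n a \<in> {1..2 * n}" using int_val[OF a] a by (cases "0 < a") (auto simp: signed_def)
  qed
  show "{1..2 * n} \<subseteq> val n ` signed n"
  proof
    fix v assume v: "v \<in> {1..2 * n}"
    define a where "a = (if v \<le> n then int v - int n - 1 else int v - int n)"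
    have "a \<in> signed n" "v = val n a" using v by (auto simp: a_def signed_def val_def)
    thus "v \<in> val n ` signed n" by blast
  qed
qed

lemma val_uminus: "a \<in> signed n \<Longrightarrow> val n a + val n (- a) = 2 * n + 1"
  unfolding of_nat_eq_iff[where 'a = int, symmetric] by (auto simp: val_def signed_def)

lemma signed_uminus: "a \<in> signed n \<Longrightarrow> - a \<in> signed n"
  by (auto simp: signed_def)

definition position :: "nat \<Rightarrow> (nat \<Rightarrow> nat) \<Rightarrow> int \<Rightarrow> nat" where
  "position n x a = inv x (val n a)"

text \<open>The cardinality makes sense for every word. If 312* is avoided, the counted values form
  an interval starting just above \<open>max a 0\<close>, so the sum is the largest of them, or
  \<open>max a 0\<close> if there is none. Other arguments get the defaults that
  \<open>bracket\<close> prescribes.\<close>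

definition code :: "nat \<Rightarrow> (nat \<Rightarrow> nat) \<Rightarrow> int \<Rightarrow> int" where
  "code n x a =
     (if a \<in> signed n
      then max a 0 + int (card {c. max a 0 < c \<and> c \<le> int n \<and> position n x c < position n x a})
      else if a = 0 then int n else 0)"

lemma B_perms_permutes: "x \<in> B_perms n \<Longrightarrow> x permutes {1..2 * n}"
  by (simp add: B_perms_def)

lemma inv_B_perms:
  assumes x: "x \<in> B_perms n" and v: "v \<in> {1..2 * n}"
  shows "inv x v \<in> {1..2 * n}" "inv x v + inv x (2 * n + 1 - v) = 2 * n + 1"
proof -
  note px = B_perms_permutes[OF x]
  show i: "inv x v \<in> {1..2 * n}" using px v by (metis permutes_in_image permutes_inv)
  have "x (inv x v) + x (2 * n + 1 - inv x v) = 2 * n + 1"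
    using x i by (auto simp: B_perms_def)
  hence "x (2 * n + 1 - inv x v) = 2 * n + 1 - v"
    using permutes_inverses[OF px] by simp
  hence "2 * n + 1 - inv x v = inv x (2 * n + 1 - v)"
    using permutes_inverses[OF px] by metis
  thus "inv x v + inv x (2 * n + 1 - v) = 2 * n + 1" using i by auto
qed

lemma val_in: "a \<in> signed n \<Longrightarrow> val n a \<in> {1..2 * n}"
  using val_image by blast

lemma position_in: "x \<in> B_perms n \<Longrightarrow> a \<in> signed n \<Longrightarrow> position n x a \<in> {1..2 * n}"
  unfolding position_def by (rule inv_B_perms(1)[OF _ val_in])

lemma position_uminus:
  assumes "x \<in> B_perms n" "a \<in> signed n"
  shows "position n x a + position n x (- a) = 2 * n + 1"
proof -
  have "2 * n + 1 - val n a = val n (- a)" using val_uminus[OF assms(2)] by simp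
  thus ?thesis using inv_B_perms(2)[OF assms(1) val_in[OF assms(2)]] by (simp add: position_def)
qed

lemma position_inj:
  assumes "x \<in> B_perms n" "a \<in> signed n" "c \<in> signed n"
  shows "position n x a = position n x c \<longleftrightarrow> a = c"
proof
  note px = B_perms_permutes[OF assms(1)]
  assume "position n x a = position n x c"
  hence "val n a = val n c" unfolding position_def using permutes_inverses(1)[OF px] by metis
  thus "a = c" using inj_on_val assms by (meson inj_onD)
qed simp

lemma x_position: "x \<in> B_perms n \<Longrightarrow> x (position n x a) = val n a"
  unfolding position_def using permutes_inverses(1)[OF B_perms_permutes] by blast

lemma position_neg_less_iff:
  assumes "x \<in> B_perms n" "a \<in> signed n" "c \<in> signed n"
  shows "position n x (- a) < position n x (- c) \<longleftrightarrow> position n x c < position n x a"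
  using position_uminus[OF assms(1,2)] position_uminus[OF assms(1,3)] by linarith

lemma down_closed_card:
  fixes S :: "int set"
  assumes S: "S \<subseteq> {m<..N}" and down: "\<And>c c'. c \<in> S \<Longrightarrow> m < c' \<Longrightarrow> c' \<le> c \<Longrightarrow> c' \<in> S" and c: "m < c"
  shows "c \<in> S \<longleftrightarrow> c \<le> m + int (card S)"
proof (cases "S = {}")
  case False
  have fin: "finite S" using S by (rule finite_subset) simp
  define M where "M = Max S"
  have M: "M \<in> S" unfolding M_def using fin False by (rule Max_in)
  have "S = {m<..M}"
  proof
    show "S \<subseteq> {m<..M}" using S fin by (auto simp: M_def)
    show "{m<..M} \<subseteq> S" using down[OF M] by auto
  qed
  moreover have "m < M" using M S by auto
  ultimately show ?thesis using c by simp
qed (use c in auto)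

text \<open>The dictionary between words and functions. If a value \<open>d' < d\<close> were
  skipped, \<open>d\<close>, \<open>a\<close>, \<open>d'\<close> would occur in this order with
  \<open>a < d' < d\<close> and \<open>d'\<close> positive, which is a 312* pattern.\<close>

lemma le_code_iff:
  assumes x: "x \<in> B_perms n" "\<not> contains_312star n x" and a: "a \<in> signed n"
    and c: "max a 0 < c" "c \<le> int n"
  shows "c \<le> code n x a \<longleftrightarrow> position n x c < position n x a"
proof -
  let ?S = "{c. max a 0 < c \<and> c \<le> int n \<and> position n x c < position n x a}"
  have "c \<in> ?S \<longleftrightarrow> c \<le> max a 0 + int (card ?S)"
  proof (rule down_closed_card)
    show "?S \<subseteq> {max a 0<..int n}" by auto
    fix d d' assume d: "d \<in> ?S" "max a 0 < d'" "d' \<le> d"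
    have s: "d \<in> signed n" "d' \<in> signed n" using d by (auto simp: signed_def)
    have "position n x d' < position n x a"
    proof (rule ccontr)
      assume neg: "\<not> position n x d' < position n x a"
      hence 1: "position n x a < position n x d'"
        using position_inj[OF x(1) a s(2)] d by auto
      have 2: "position n x d < position n x a" using d by simp
      have "d' < d" using neg d by (cases "d = d'") auto
      hence 3: "val n d' < val n d" using val_less_iff s by simp
      have "a < d'" using d by simp
      hence 4: "val n a < val n d'" using val_less_iff s a by simp
      have 5: "1 \<le> position n x d" "position n x d' \<le> 2 * n"
        using position_in[OF x(1) s(1)] position_in[OF x(1) s(2)] by simp_all
      have 6: "n + 1 \<le> val n d'" using int_val[OF s(2)] d by simp
      have "contains_312star n x"
        unfolding contains_312star_def
        by (rule exI[of _ "position n x d"], rule exI[of _ "position n x a"], rule exI[of _ "position n x d'"])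
          (simp only: x_position[OF x(1)] 1 2 3 4 5 6 simp_thms)
      thus False using x by simp
    qed
    thus "d' \<in> ?S" using d by auto
  qed (rule c)
  thus ?thesis using a c by (simp add: code_def)
qed

lemma code_ge: "a \<in> signed n \<Longrightarrow> max a 0 \<le> code n x a"
  by (simp add: code_def)

lemma code_le:
  assumes "a \<in> signed n"
  shows "code n x a \<le> int n"
proof -
  have "card {c. max a 0 < c \<and> c \<le> int n \<and> position n x c < position n x a} \<le> card {max a 0<..int n}"
    by (rule card_mono) auto
  thus ?thesis using assms by (auto simp: code_def signed_def)
qed

lemma bracket_code:
  assumes n: "1 \<le> n" and x: "x \<in> B_perms n" "\<not> contains_312star n x"
  shows "bracket (int n) (code n x)"
proof
  have pos: "i \<in> signed n" "- i \<in> signed n" if "1 \<le> i" "i \<le> int n" for i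
    using that by (auto simp: signed_def)
  show "1 \<le> int n" using n by simp
  show "code n x 0 = int n" by (simp add: code_def signed_def)
  show "i \<le> code n x i" "code n x i \<le> int n" if "1 \<le> i" "i \<le> int n" for i
    using code_ge[of i n x] code_le[of i n x] pos that by auto
  show "0 \<le> code n x (- k)" "code n x (- k) \<le> int n" if "1 \<le> k" "k \<le> int n" for k
    using code_ge[of "- k" n x] code_le[of "- k" n x] pos[of k] that by auto
  show "l \<le> code n x (- k) \<longleftrightarrow> k \<le> code n x (- l)"
    if kl: "1 \<le> k" "k \<le> int n" "1 \<le> l" "l \<le> int n" for k l
    using le_code_iff[OF x, of "- k" l] le_code_iff[OF x, of "- l" k]
      position_neg_less_iff[OF x(1), of "- l" k] pos[of k] pos[of l] kl by auto
  show "code n x a = 0" if "a < - int n \<or> int n < a" for a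
    using that by (auto simp: code_def signed_def)
  show "code n x j \<le> code n x a" if j: "a < j" "0 < j" "j \<le> code n x a" for a j
  proof -
    have "a = 0 \<or> a \<in> signed n" using j by (auto simp: code_def split: if_splits)
    moreover have "j \<le> int n" using j code_le[of a n x] calculation
      by (auto simp: code_def signed_def)
    hence jn: "j \<in> signed n" "j \<le> int n" using j by (auto simp: signed_def)
    ultimately show ?thesis
    proof (elim disjE)
      assume "a = 0"
      thus ?thesis using code_le[OF jn(1)] by (simp add: code_def signed_def)
    next
      assume a: "a \<in> signed n"
      have ja: "position n x j < position n x a"
        using le_code_iff[OF x a, of j] j jn by simp
      show ?thesis
      proof (cases "code n x j = j")
        case False
        hence c: "max j 0 < code n x j" using code_ge[OF jn(1), of x] j by simp
        hence "position n x (code n x j) < position n x j"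
          using le_code_iff[OF x jn(1) c code_le[OF jn(1)]] by simp
        thus ?thesis using le_code_iff[OF x a, of "code n x j"] code_le[OF jn(1), of x] c j ja by auto
      qed (use j in simp)
    qed
  qed
qed

lemma before_iff:
  assumes "x \<in> B_perms n"
  shows "before x v u \<longleftrightarrow> inv x v < inv x u"
proof -
  note px = B_perms_permutes[OF assms]
  show ?thesis
  proof
    assume "before x v u"
    then obtain i j where "i < j" "x i = v" "x j = u" by (auto simp: before_def)
    thus "inv x v < inv x u" using permutes_inverses(2)[OF px] by auto
  next
    assume "inv x v < inv x u"
    thus "before x v u" unfolding before_def using permutes_inverses(1)[OF px] by blast
  qed
qed

text \<open>\<open>before\<close> ranges over all natural positions. A value above
  \<open>2 * n\<close> is fixed and stands behind every smaller one, and 0 stands first, so neither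
  takes part in an inversion.\<close>

lemma before_signed:
  assumes x: "x \<in> B_perms n" and uv: "u < v" "before x v u"
  shows "\<exists>a\<in>signed n. \<exists>c\<in>signed n. a < c \<and> u = val n a \<and> v = val n c"
proof -
  note px = permutes_inv[OF B_perms_permutes[OF x]]
  have less: "inv x v < inv x u" using uv before_iff[OF x] by simp
  have in_iff: "inv x w \<in> {1..2 * n} \<longleftrightarrow> w \<in> {1..2 * n}" for w using permutes_in_image[OF px] .
  have out: "w \<notin> {1..2 * n} \<Longrightarrow> inv x w = w" for w using px by (simp add: permutes_def)
  have v: "v \<in> {1..2 * n}"
  proof (rule ccontr)
    assume nv: "v \<notin> {1..2 * n}"
    hence "2 * n < v" "inv x v = v" using uv out by auto
    thus False using less in_iff[of u] out[of u] uv by (cases "u \<in> {1..2 * n}") auto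
  qed
  have u: "u \<in> {1..2 * n}"
  proof (rule ccontr)
    assume "u \<notin> {1..2 * n}"
    hence "u = 0" "inv x u = u" using uv v out by auto
    thus False using less by simp
  qed
  obtain a c where "a \<in> signed n" "c \<in> signed n" "u = val n a" "v = val n c"
    using u v val_image by blast
  thus ?thesis using val_less_iff uv by blast
qed

lemma weak_le_iff_code:
  assumes x: "x \<in> B_perms n" "\<not> contains_312star n x" and y: "y \<in> B_perms n" "\<not> contains_312star n y"
  shows "weak_le x y \<longleftrightarrow> code n x \<le> code n y"
proof
  assume le: "weak_le x y"
  show "code n x \<le> code n y"
    unfolding le_fun_def
  proof
    fix a
    show "code n x a \<le> code n y a"
    proof (cases "a \<in> signed n \<and> max a 0 < code n x a")
      case False
      thus ?thesis using code_ge[of a n y] by (auto simp: code_def)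
    next
      case True
      \<comment> \<open>\<open>code n x a\<close> is itself a value in front of \<open>a\<close>, so
        the inversion it forms with \<open>a\<close> passes to \<open>y\<close>.\<close>
      let ?c = "code n x a"
      have c: "?c \<in> signed n" "?c \<le> int n" "a < ?c" using True code_le[of a n x] by (auto simp: signed_def)
      have "position n x ?c < position n x a" using le_code_iff[OF x, of a ?c] True c by simp
      hence "before x (val n ?c) (val n a)" using before_iff[OF x(1)] by (simp add: position_def)
      hence "before y (val n ?c) (val n a)" using le c True val_less_iff[of a n ?c]
        by (auto simp: weak_le_def)
      hence "position n y ?c < position n y a" using before_iff[OF y(1)] by (simp add: position_def)
      thus ?thesis using le_code_iff[OF y, of a ?c] True c by simp
    qed
  qed
next
  assume le: "code n x \<le> code n y"
  have pos: "position n y c < position n y a"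
    if "a \<in> signed n" "a < c" "0 < c" "c \<in> signed n" "position n x c < position n x a" for a c
    using that le_code_iff[OF x, of a c] le_code_iff[OF y, of a c] le
    by (auto simp: signed_def le_fun_def intro: order_trans)
  show "weak_le x y"
    unfolding weak_le_def
  proof (intro allI impI, elim conjE)
    fix u v assume uv: "u < v" "before x v u"
    then obtain a c where ac: "a \<in> signed n" "c \<in> signed n" "a < c" "u = val n a" "v = val n c"
      using before_signed[OF x(1)] by blast
    have "position n x c < position n x a" using uv before_iff[OF x(1)] ac by (simp add: position_def)
    \<comment> \<open>For \<open>c < 0\<close> the code does not see the pair directly, but the
      larger value \<open>- a\<close> of the mirrored pair \<open>(- c, - a)\<close> is
      positive.\<close>
    hence "position n y c < position n y a"
      using pos[of a c] pos[of "- c" "- a"] ac position_neg_less_iff[OF x(1), of a c]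
        position_neg_less_iff[OF y(1), of a c] signed_uminus[of a n] signed_uminus[of c n]
      by (cases "0 < c") (auto simp: signed_def)
    thus "before y v u" using before_iff[OF y(1)] ac by (simp add: position_def)
  qed
qed

text \<open>Positions are recovered from the relative order alone; hence two words with the same
  inversions coincide.\<close>

lemma inv_eq_card:
  assumes x: "x \<in> B_perms n" and v: "v \<in> {1..2 * n}"
  shows "inv x v = Suc (card {u \<in> {1..2 * n}. inv x u < inv x v})"
proof -
  note px = permutes_inv[OF B_perms_permutes[OF x]]
  have "inv x ` {u \<in> {1..2 * n}. inv x u < inv x v} = {1..<inv x v}"
  proof
    show "inv x ` {u \<in> {1..2 * n}. inv x u < inv x v} \<subseteq> {1..<inv x v}"
    proof (rule image_subsetI)
      fix u assume "u \<in> {u \<in> {1..2 * n}. inv x u < inv x v}"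
      thus "inv x u \<in> {1..<inv x v}" using inv_B_perms(1)[OF x, of u] by simp
    qed
    show "{1..<inv x v} \<subseteq> inv x ` {u \<in> {1..2 * n}. inv x u < inv x v}"
    proof
      fix i assume i: "i \<in> {1..<inv x v}"
      hence "i \<in> {1..2 * n}" using inv_B_perms(1)[OF x v] by simp
      then obtain u where "u \<in> {1..2 * n}" "i = inv x u" using permutes_image[OF px] by blast
      thus "i \<in> inv x ` {u \<in> {1..2 * n}. inv x u < inv x v}" using i by auto
    qed
  qed
  moreover have "inj_on (inv x) {u \<in> {1..2 * n}. inv x u < inv x v}"
    using permutes_inj[OF px] by (rule inj_on_subset) simp
  ultimately have "card {u \<in> {1..2 * n}. inv x u < inv x v} = card {1..<inv x v}"
    using card_image by metis
  thus ?thesis using inv_B_perms(1)[OF x v] by simp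
qed

lemma weak_le_antisym:
  assumes x: "x \<in> B_perms n" and y: "y \<in> B_perms n" and le: "weak_le x y" "weak_le y x"
  shows "x = y"
proof -
  note px = B_perms_permutes[OF x] and py = B_perms_permutes[OF y]
  have same: "inv x u < inv x v \<longleftrightarrow> inv y u < inv y v" for u v
  proof -
    have "inj (inv x)" "inj (inv y)" using px py permutes_inv permutes_inj by blast+
    hence "inv x u = inv x v \<longleftrightarrow> u = v" "inv y u = inv y v \<longleftrightarrow> u = v" by (auto simp: inj_eq)
    moreover have "inv x b < inv x a \<longleftrightarrow> inv y b < inv y a" if "a < b" for a b
      using that le before_iff[OF x] before_iff[OF y] by (auto simp: weak_le_def)
    ultimately show ?thesis by (metis linorder_neqE not_less_iff_gr_or_eq)
  qed
  have "inv x v = inv y v" for v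
  proof (cases "v \<in> {1..2 * n}")
    case True
    thus ?thesis using inv_eq_card[OF x] inv_eq_card[OF y] same by simp
  next
    case False
    thus ?thesis using permutes_inv[OF px] permutes_inv[OF py] by (simp add: permutes_def)
  qed
  hence "inv x = inv y" by (rule ext)
  thus ?thesis using px py by (metis permutes_inv_inv)
qed

lemma inj_on_code: "inj_on (code n) {x \<in> B_perms n. \<not> contains_312star n x}"
  by (rule inj_onI) (auto intro: weak_le_antisym simp: weak_le_iff_code)

section \<open>Every bracket function comes from a word\<close>

context bracket
begin

text \<open>For \<open>a < c\<close> this is the statement that \<open>c\<close> is to stand in
  front of \<open>a\<close>. A negative \<open>c\<close> is replaced by the mirrored pair
  \<open>(- c, - a)\<close>.\<close>

definition inverted :: "int \<Rightarrow> int \<Rightarrow> bool" where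
  "inverted a c = (if 0 < c then c \<le> f a else - a \<le> f (- c))"

definition precedes :: "int \<Rightarrow> int \<Rightarrow> bool" where
  "precedes c a = (if a < c then inverted a c else c < a \<and> \<not> inverted c a)"

definition X :: "int set" where
  "X = {- n..n} - {0}"

lemma X_uminus: "a \<in> X \<longleftrightarrow> - a \<in> X"
  by (auto simp: X_def)

lemma inverted_uminus:
  assumes "a \<in> X" "c \<in> X" "a < c"
  shows "inverted (- c) (- a) \<longleftrightarrow> inverted a c"
  using assms sym[of "- a" c] by (auto simp: inverted_def X_def)

text \<open>The closure and co-closure that characterise inversion sets of linear orders. For a
  positive middle value the first is laminarity and the second holds because
  \<open>c < d <= f a\<close>; a negative middle value is treated by negating all three.\<close>

lemma inverted_trans:
  assumes X: "a \<in> X" "c \<in> X" "d \<in> X" and less: "a < c" "c < d"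
  shows "inverted a c \<Longrightarrow> inverted c d \<Longrightarrow> inverted a d"
    and "inverted a d \<Longrightarrow> inverted a c \<or> inverted c d"
proof -
  have 1: "inverted a c \<Longrightarrow> inverted c d \<Longrightarrow> inverted a d"
    "inverted a d \<Longrightarrow> inverted a c" if "a < c" "c < d" "0 < c" for a c d
    using that laminar[of a c] by (auto simp: inverted_def)
  have sym: "inverted (- c) (- a) = inverted a c" "inverted (- d) (- c) = inverted c d"
    "inverted (- d) (- a) = inverted a d"
    using inverted_uminus[OF X(1,2) less(1)] inverted_uminus[OF X(2,3) less(2)] inverted_uminus[OF X(1,3)] less
    by auto
  have "c \<noteq> 0" using X by (simp add: X_def)
  thus "inverted a c \<Longrightarrow> inverted c d \<Longrightarrow> inverted a d"
    and "inverted a d \<Longrightarrow> inverted a c \<or> inverted c d"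
    using 1[of a c d] 1[of "- d" "- c" "- a"] less sym by (cases "0 < c"; auto)+
qed

lemma precedes_irrefl: "\<not> precedes a a"
  by (simp add: precedes_def)

lemma precedes_total: "a \<noteq> c \<Longrightarrow> precedes a c \<longleftrightarrow> \<not> precedes c a"
  by (auto simp: precedes_def)

lemma precedes_asym: "precedes a c \<Longrightarrow> \<not> precedes c a"
  using precedes_total[of a c] precedes_irrefl by (cases "a = c") auto

lemma precedes_trans:
  assumes X: "a \<in> X" "c \<in> X" "d \<in> X" and "precedes a c" "precedes c d"
  shows "precedes a d"
proof -
  have "a \<noteq> c" "c \<noteq> d" "a \<noteq> d" using assms(4,5) precedes_irrefl precedes_total[of a c] by auto
  then consider "a < c" "c < d" | "a < d" "d < c" | "c < a" "a < d" | "c < d" "d < a" | "d < a" "a < c" | "d < c" "c < a"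
    by linarith
  thus ?thesis
  proof cases
    case 1
    with inverted_trans(2)[of a c d] X assms(4,5) show ?thesis by (auto simp: precedes_def)
  next
    case 2
    with inverted_trans(1)[of a d c] X assms(4,5) show ?thesis by (auto simp: precedes_def)
  next
    case 3
    with inverted_trans(1)[of c a d] X assms(4,5) show ?thesis by (auto simp: precedes_def)
  next
    case 4
    with inverted_trans(2)[of c d a] X assms(4,5) show ?thesis by (auto simp: precedes_def)
  next
    case 5
    with inverted_trans(2)[of d a c] X assms(4,5) show ?thesis by (auto simp: precedes_def)
  next
    case 6
    with inverted_trans(1)[of d c a] X assms(4,5) show ?thesis by (auto simp: precedes_def)
  qed
qed

lemma precedes_uminus:
  assumes "a \<in> X" "c \<in> X"
  shows "precedes (- a) (- c) \<longleftrightarrow> precedes c a"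
  using assms inverted_uminus[of a c] inverted_uminus[of c a] by (auto simp: precedes_def)

lemma finite_X: "finite X" by (simp add: X_def)

definition place :: "int \<Rightarrow> nat" where
  "place a = Suc (card {c \<in> X. precedes c a})"

lemma place_less:
  assumes "a \<in> X" "c \<in> X" "precedes a c"
  shows "place a < place c"
proof -
  have "{d \<in> X. precedes d a} \<subset> {d \<in> X. precedes d c}"
    using assms precedes_trans precedes_irrefl by blast
  thus ?thesis using finite_X by (simp add: place_def psubset_card_mono)
qed

lemma place_less_iff:
  assumes "a \<in> X" "c \<in> X"
  shows "place a < place c \<longleftrightarrow> precedes a c"
  using assms place_less[of a c] place_less[of c a] precedes_total[of a c] precedes_irrefl
  by (cases "a = c") auto

lemma place_uminus:
  assumes a: "a \<in> X"
  shows "place a + place (- a) = card X + 1"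
proof -
  have "{c \<in> X. precedes c (- a)} = uminus ` {c \<in> X. precedes a c}"
  proof
    show "uminus ` {c \<in> X. precedes a c} \<subseteq> {c \<in> X. precedes c (- a)}"
      using a X_uminus precedes_uminus by auto
    show "{c \<in> X. precedes c (- a)} \<subseteq> uminus ` {c \<in> X. precedes a c}"
    proof
      fix c assume "c \<in> {c \<in> X. precedes c (- a)}"
      hence "- c \<in> {c \<in> X. precedes a c}"
        using a X_uminus[of c] precedes_uminus[of "- c" a] by auto
      thus "c \<in> uminus ` {c \<in> X. precedes a c}" by force
    qed
  qed
  hence 1: "card {c \<in> X. precedes c (- a)} = card {c \<in> X. precedes a c}"
    by (simp add: card_image)
  define A where "A = {c \<in> X. precedes c a}"
  define B where "B = {c \<in> X. precedes a c}"
  have "X = insert a (A \<union> B)"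
  proof (rule Set.set_eqI)
    fix c
    show "c \<in> X \<longleftrightarrow> c \<in> insert a (A \<union> B)"
      using a precedes_total[of c a] by (auto simp: A_def B_def)
  qed
  moreover have "a \<notin> A \<union> B" using precedes_irrefl by (auto simp: A_def B_def)
  moreover have "A \<inter> B = {}" by (auto simp: A_def B_def dest: precedes_asym)
  moreover have "finite A" "finite B" using finite_X by (auto simp: A_def B_def)
  ultimately have "card X = Suc (card A + card B)"
    by (simp add: card_Un_disjoint)
  thus ?thesis using 1 by (simp add: place_def A_def B_def)
qed

lemma place_in: "a \<in> X \<Longrightarrow> place a \<in> {1..card X}"
  using place_uminus[of a] by (auto simp: place_def)

lemma bij_betw_place: "bij_betw place X {1..card X}"
proof -
  have "inj_on place X"
    by (rule inj_onI) (metis place_less_iff precedes_total less_irrefl)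
  moreover from this have "place ` X = {1..card X}"
    using place_in by (intro card_subset_eq) (auto simp: card_image)
  ultimately show ?thesis by (simp add: bij_betw_def)
qed

end

lemma code_surj:
  assumes f: "bracket (int n) f"
  shows "\<exists>x. x \<in> B_perms n \<and> \<not> contains_312star n x \<and> code n x = f"
proof -
  interpret bracket "int n" f by (rule f)
  have X: "X = signed n" by (simp add: X_def signed_def)
  have bv: "bij_betw (val n) (signed n) {1..2 * n}"
    using inj_on_val val_image by (simp add: bij_betw_def)
  have cX: "card X = 2 * n" using bij_betw_same_card[OF bv] X by simp
  define u where "u = inv_into (signed n) (val n)"
  have bu: "bij_betw u {1..2 * n} (signed n)" unfolding u_def by (rule bij_betw_inv_into[OF bv])
  have uval: "u (val n a) = a" if "a \<in> signed n" for a
    unfolding u_def by (rule inv_into_f_f[OF inj_on_val that])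
  \<comment> \<open>\<open>y\<close> sends a value to its position, so the word is the inverse of
    \<open>y\<close>; off \<open>{1..2 * n}\<close> it is the identity, as \<open>permutes\<close>
    demands.\<close>
  define y where "y = (\<lambda>v. if v \<in> {1..2 * n} then place (u v) else v)"
  have "bij_betw (place \<circ> u) {1..2 * n} {1..2 * n}"
    using bij_betw_trans[OF bu] bij_betw_place X cX by simp
  hence "bij_betw y {1..2 * n} {1..2 * n}"
    by (subst bij_betw_cong[of _ _ "place \<circ> u"]) (auto simp: y_def)
  hence py: "y permutes {1..2 * n}"
    by (rule bij_imp_permutes) (auto simp: y_def)
  define x where "x = inv y"
  have px: "x permutes {1..2 * n}" unfolding x_def by (rule permutes_inv[OF py])
  have inv_x: "inv x = y" unfolding x_def by (rule permutes_inv_inv[OF py])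
  have yval: "y (val n a) = place a" if "a \<in> signed n" for a
    using that val_in uval by (simp add: y_def)
  have xval: "x (place a) = val n a" if "a \<in> signed n" for a
    using yval[OF that] permutes_inverses(2)[OF py] by (metis x_def)
  have surj: "\<exists>a\<in>signed n. i = place a" if "i \<in> {1..2 * n}" for i
    using that bij_betw_place X cX by (auto simp: bij_betw_def)
  have xB: "x \<in> B_perms n"
    unfolding B_perms_def
  proof (intro CollectI conjI ballI px)
    fix i assume i: "i \<in> {1..2 * n}"
    then obtain a where a: "a \<in> signed n" "i = place a" using surj by blast
    hence "2 * n + 1 - i = place (- a)" using place_uminus[of a] X cX by simp
    thus "x i + x (2 * n + 1 - i) = 2 * n + 1"
      using a xval signed_uminus val_uminus by simp
  qed
  have pos: "position n x a = place a" if "a \<in> signed n" for a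
    using yval[OF that] by (simp add: position_def inv_x)
  have avoid: "\<not> contains_312star n x"
  proof
    assume "contains_312star n x"
    then obtain i j k where ijk: "1 \<le> i" "i < j" "j < k" "k \<le> 2 * n"
      and xs: "x j < x k" "x k < x i" "n + 1 \<le> x k" unfolding contains_312star_def by blast
    obtain a c d where s: "a \<in> signed n" "c \<in> signed n" "d \<in> signed n"
      and eq: "j = place a" "k = place c" "i = place d"
      using surj[of j] surj[of k] surj[of i] ijk by auto
    have less: "a < c" "c < d" using xs s eq xval val_less_iff by auto
    have "0 < c" using xs(3) s eq xval by (auto simp: val_def signed_def split: if_splits)
    moreover have "precedes d a" "precedes a c"
      using place_less_iff s X ijk eq by auto
    \<comment> \<open>\<open>d\<close> in front of \<open>a\<close> means \<open>d <= f a\<close>,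
      hence \<open>c <= f a\<close>, which puts \<open>c\<close> in front of
      \<open>a\<close>.\<close>
    ultimately show False using less by (auto simp: precedes_def inverted_def split: if_splits)
  qed
  have "code n x a = f a" for a
  proof (cases "a \<in> signed n")
    case True
    have lb: "max a 0 \<le> f a"
      using True pos_ge[of a] nonneg[of a] by (cases "1 \<le> a") (auto simp: signed_def)
    have iff: "c \<le> code n x a \<longleftrightarrow> c \<le> f a" if c: "max a 0 < c" "c \<le> int n" for c
    proof -
      have cs: "c \<in> signed n" using c by (auto simp: signed_def)
      have "c \<le> code n x a \<longleftrightarrow> precedes c a"
        using le_code_iff[OF xB avoid True c] pos place_less_iff True cs X by simp
      also have "\<dots> \<longleftrightarrow> c \<le> f a" using c by (simp add: precedes_def inverted_def)
      finally show ?thesis .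
    qed
    show ?thesis
      using iff[of "code n x a"] iff[of "f a"] lb code_ge[OF True, of x] code_le[OF True, of x] le_n[of a]
      by linarith
  next
    case False
    thus ?thesis using zero outside[of a] by (auto simp: code_def signed_def)
  qed
  thus ?thesis using xB avoid by blast
qed

lemma bij_betw_code:
  assumes "1 \<le> n"
  shows "bij_betw (code n) (carrier (TamB n)) (brackets (int n))"
proof -
  have "code n ` {x \<in> B_perms n. \<not> contains_312star n x} = brackets (int n)"
    using bracket_code[OF assms] code_surj by (force simp: brackets_def)
  thus ?thesis using inj_on_code by (simp add: bij_betw_def TamB_def)
qed

lemma Pop_poly_TamB:
  assumes n: "1 \<le> n"
  shows "Pop_poly (TamB n) =
    (\<Sum>b\<in>pop (int n) ` brackets (int n). monom 1 (card {g. covers_in (brackets (int n)) b g}))"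
proof (rule Pop_poly_order_iso)
  show "eq (TamB n) = (=)" by (simp add: TamB_def)
  show "bij_betw (code n) (carrier (TamB n)) (brackets (int n))" by (rule bij_betw_code[OF n])
  show "x \<sqsubseteq>\<^bsub>TamB n\<^esub> y \<longleftrightarrow> code n x \<le> code n y"
    if "x \<in> carrier (TamB n)" "y \<in> carrier (TamB n)" for x y
    using that weak_le_iff_code by (simp add: TamB_def)
  show "pop (int n) v \<in> brackets (int n)" "pop (int n) v \<le> v" if "v \<in> brackets (int n)" for v
    using that bracket.bracket_pop bracket.pop_le by (auto simp: brackets_def le_fun_def)
  show "pop (int n) v \<le> h" if "covers_in (brackets (int n)) h v" for v h
    using that bracket.pop_le_lower_cover[of "int n" v h] by (auto simp: covers_in_def brackets_def)
  show "g \<le> pop (int n) v"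
    if "v \<in> brackets (int n)" "g \<le> v" "\<And>h. covers_in (brackets (int n)) h v \<Longrightarrow> g \<le> h" for v g
    using that bracket.lower_bound_le_pop[of "int n" v g] by (auto simp: brackets_def)
qed

section \<open>The image of Pop\<close>

text \<open>For \<open>0 < a < i\<close> the equation \<open>f a = f i\<close> says that
  \<open>i\<close> is on the rightmost branch from \<open>a\<close>; for \<open>a <= 0\<close> it
  says that \<open>i\<close> ends where a row or, by the sentinel, the whole forest ends. Both are
  forbidden to an inner node \<open>i\<close>.\<close>

definition pop_image :: "int \<Rightarrow> (int \<Rightarrow> int) set" where
  "pop_image n = {f. bracket n f \<and> f (- n) \<noteq> n \<and> (\<forall>a i. a < i \<and> 0 < i \<and> i < f i \<longrightarrow> f a \<noteq> f i)}"

text \<open>The next sibling of a node becomes its last child, likewise the next tree of its run for the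
  root of a tree, and every row of the partition grows to the next cut.\<close>

definition pop_inv :: "int \<Rightarrow> (int \<Rightarrow> int) \<Rightarrow> int \<Rightarrow> int" where
  "pop_inv n f a =
     (if a < - n \<or> n < a then 0
      else if 0 < a then Min {c. \<exists>b<a. c = f b \<and> a \<le> c}
      else if a = 0 then n
      else Min (insert n {c. \<exists>b\<le>0. c = f b \<and> f a < c}))"

context bracket
begin

lemma pop_in_pop_image: "pop n f \<in> pop_image n"
proof -
  have "pop n f (- n) \<noteq> n"
  proof
    assume eq: "pop n f (- n) = n"
    hence fn: "f (- n) = n" using pop_le[of "- n"] le_n[of "- n"] by simp
    moreover have "max (- n) 0 < f (- n)" using fn n_pos by simp
    ultimately show False
      using eq next_end(2)[of "- n"] n_pos by (simp add: pop_def)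
  qed
  moreover have "pop n f a \<noteq> pop n f i" if i: "a < i" "0 < i" "i < pop n f i" for a i
  proof
    assume eq: "pop n f a = pop n f i"
    have "i < f i" using i pop_le[of i] by simp
    hence pi: "pop n f i = next_end n f i - 1" and ne: "max i 0 < f i"
      using i by (simp_all add: pop_def)
    show False
    proof (cases "pop n f a = f a")
      case True
      hence "f i \<le> pop n f i" using laminar[of a i] i eq by simp
      thus False using pi next_end(2)[OF ne] by simp
    next
      case False
      hence pa: "pop n f a = next_end n f a - 1" and nea: "max a 0 < f a"
        by (auto simp: pop_def split: if_splits)
      hence same: "next_end n f a = next_end n f i" using pi eq by simp
      hence "f a = f i" using next_end(3)[OF ne] next_end(3)[OF nea] by simp
      moreover have "f i < next_end n f a"
        using next_end(4)[OF nea, of i] next_end(1)[OF ne] i same by simp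
      ultimately show False using next_end(2)[OF nea] by simp
    qed
  qed
  ultimately show ?thesis using bracket_pop by (auto simp: pop_image_def)
qed

lemma pop_inv_pos:
  assumes "1 \<le> i" "i \<le> n"
  shows "\<exists>b<i. i \<le> f b \<and> pop_inv n f i = f b" "\<And>b. b < i \<Longrightarrow> i \<le> f b \<Longrightarrow> pop_inv n f i \<le> f b"
proof -
  let ?S = "{c. \<exists>b<i. c = f b \<and> i \<le> c}"
  have eq: "pop_inv n f i = Min ?S" using assms by (simp add: pop_inv_def)
  have fin: "finite ?S" by (rule finite_subset[of _ "{0..n}"]) (use nonneg le_n in auto)
  have "n \<in> ?S" using assms zero by (intro CollectI exI[of _ 0]) auto
  hence "Min ?S \<in> ?S" using fin by (intro Min_in) auto
  thus "\<exists>b<i. i \<le> f b \<and> pop_inv n f i = f b" using eq by auto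
  show "pop_inv n f i \<le> f b" if "b < i" "i \<le> f b" for b
    unfolding eq using that fin by (intro Min_le) auto
qed

lemma pop_inv_neg:
  assumes "1 \<le> k" "k \<le> n"
  shows "pop_inv n f (- k) = n \<or> (\<exists>b\<le>0. f (- k) < f b \<and> pop_inv n f (- k) = f b)"
    "pop_inv n f (- k) \<le> n"
    "\<And>b. b \<le> 0 \<Longrightarrow> f (- k) < f b \<Longrightarrow> pop_inv n f (- k) \<le> f b"
proof -
  let ?S = "{c. \<exists>b\<le>0. c = f b \<and> f (- k) < c}"
  have eq: "pop_inv n f (- k) = Min (insert n ?S)" using assms by (simp add: pop_inv_def)
  have fin: "finite (insert n ?S)" by (rule finite_subset[of _ "{0..n}"]) (use nonneg le_n n_pos in auto)
  have "Min (insert n ?S) \<in> insert n ?S" using fin by (intro Min_in) auto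
  thus "pop_inv n f (- k) = n \<or> (\<exists>b\<le>0. f (- k) < f b \<and> pop_inv n f (- k) = f b)" using eq by auto
  show "pop_inv n f (- k) \<le> n" unfolding eq using fin by (intro Min_le) auto
  show "pop_inv n f (- k) \<le> f b" if "b \<le> 0" "f (- k) < f b" for b
    unfolding eq using that fin by (intro Min_le) auto
qed

lemma pop_inv_cell_iff:
  assumes "1 \<le> k" "k \<le> n" "l \<le> n"
  shows "l \<le> pop_inv n f (- k) \<longleftrightarrow> \<not> (\<exists>b\<le>0. f (- k) < f b \<and> f b < l)"
proof
  show "l \<le> pop_inv n f (- k) \<Longrightarrow> \<not> (\<exists>b\<le>0. f (- k) < f b \<and> f b < l)"
    using pop_inv_neg(3)[OF assms(1,2)] by force
  show "\<not> (\<exists>b\<le>0. f (- k) < f b \<and> f b < l) \<Longrightarrow> l \<le> pop_inv n f (- k)"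
    using pop_inv_neg(1)[OF assms(1,2)] assms(3) by force
qed

text \<open>Makes the partition of \<open>pop_inv\<close> self-conjugate. Row \<open>- b\<close>
  reaches column \<open>f (- k) + 1\<close> but not column \<open>l\<close>, and row
  \<open>k\<close> stops just before column \<open>f (- k) + 1\<close>; so the height of this column
  lies strictly between \<open>f (- l)\<close> and \<open>k\<close>.\<close>

lemma value_between_sym:
  assumes kl: "1 \<le> k" "k \<le> n" "1 \<le> l" "l \<le> n"
    and b: "b \<le> 0" "f (- k) < f b" "f b < l"
  shows "\<exists>b\<le>0. f (- l) < f b \<and> f b < k"
proof (intro exI conjI)
  have k0: "0 \<le> f (- k)" by (rule nonneg)
  have b0: "b \<noteq> 0" using b kl zero by auto
  have bn: "- n \<le> b" using in_range[of b] b k0 by simp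
  have bk: "- b < k"
    using neg_antimono[of k "- b"] b kl bn by force
  let ?b = "f (- k) + 1"
  have r: "1 \<le> ?b" "?b \<le> n" using k0 b kl by auto
  show "- ?b \<le> 0" using r by simp
  have "f (- l) < - b" using sym[of "- b" l] b b0 bn kl by auto
  moreover have "- b \<le> f (- ?b)" using sym[of "- b" ?b] b b0 bn r by auto
  ultimately show "f (- l) < f (- ?b)" by simp
  show "f (- ?b) < k" using sym[of k ?b] kl r by auto
qed

lemma bracket_pop_inv: "bracket n (pop_inv n f)"
proof
  show "1 \<le> n" by (rule n_pos)
  show "pop_inv n f 0 = n" using n_pos by (simp add: pop_inv_def)
  show "i \<le> pop_inv n f i" "pop_inv n f i \<le> n" if "1 \<le> i" "i \<le> n" for i
    using pop_inv_pos(1)[OF that] le_n by auto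
  show "0 \<le> pop_inv n f (- k)" "pop_inv n f (- k) \<le> n" if "1 \<le> k" "k \<le> n" for k
    using pop_inv_neg(1,2)[OF that] nonneg n_pos by auto
  show "l \<le> pop_inv n f (- k) \<longleftrightarrow> k \<le> pop_inv n f (- l)"
    if "1 \<le> k" "k \<le> n" "1 \<le> l" "l \<le> n" for k l
    using value_between_sym[of k l] value_between_sym[of l k] that
    by (auto simp: pop_inv_cell_iff)
  show "pop_inv n f a = 0" if "a < - n \<or> n < a" for a
    using that by (simp add: pop_inv_def)
  show "pop_inv n f j \<le> pop_inv n f a" if j: "a < j" "0 < j" "j \<le> pop_inv n f a" for a j
  proof -
    have a: "- n \<le> a" "a \<le> n" using j by (auto simp: pop_inv_def split: if_splits)
    \<comment> \<open>The value at \<open>a\<close> is an old value \<open>f b\<close> with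
      \<open>b < j\<close>, so it competes in the minimum that defines
      \<open>pop_inv n f j\<close>.\<close>
    have "\<exists>b<j. pop_inv n f a = f b"
    proof (cases "0 < a")
      case True
      then obtain b where "b < a" "pop_inv n f a = f b" using pop_inv_pos(1)[of a] a by auto
      with j show ?thesis by (intro exI[of _ b]) auto
    next
      case False
      show ?thesis
      proof (cases "a = 0")
        case True
        thus ?thesis using zero j n_pos by (intro exI[of _ 0]) (auto simp: pop_inv_def)
      next
        case False
        have "pop_inv n f a = n \<or> (\<exists>b\<le>0. f a < f b \<and> pop_inv n f a = f b)"
          using False \<open>\<not> 0 < a\<close> pop_inv_neg(1)[of "- a"] a by simp
        thus ?thesis
        proof (elim disjE exE conjE)
          assume "pop_inv n f a = n"
          with zero j show ?thesis by (intro exI[of _ 0]) auto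
        next
          fix b assume "b \<le> 0" "pop_inv n f a = f b"
          with j show ?thesis by (intro exI[of _ b]) auto
        qed
      qed
    qed
    then obtain b where b: "b < j" "pop_inv n f a = f b" by blast
    have "j \<le> n" using j b le_n[of b] by simp
    thus ?thesis using pop_inv_pos(2)[of j b] b j by simp
  qed
qed

lemma next_end_eqI:
  assumes "max a 0 < y" "y \<le> n" "f y = f a" "\<And>z. a < z \<Longrightarrow> 0 < z \<Longrightarrow> z < y \<Longrightarrow> f z \<noteq> f a"
  shows "next_end n f a = y"
  unfolding next_end_def
proof (rule Min_eqI)
  show "finite {y. max a 0 < y \<and> y \<le> n \<and> f y = f a}"
    by (rule finite_subset[of _ "{0..n}"]) auto
  show "y \<in> {y. max a 0 < y \<and> y \<le> n \<and> f y = f a}" using assms by simp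
  fix z assume "z \<in> {y. max a 0 < y \<and> y \<le> n \<and> f y = f a}"
  thus "y \<le> z" using assms(4)[of z] by force
qed

end

text \<open>Where a value grows, the added part is a single tree of \<open>pop_inv n f\<close> with
  root \<open>f a + 1\<close>. So \<open>f a + 1\<close> is the new \<open>next_end\<close>, and
  \<open>pop\<close> takes back exactly this tree.\<close>

lemma pop_pop_inv:
  assumes "f \<in> pop_image n"
  shows "pop n (pop_inv n f) = f"
proof
  interpret bracket n f using assms by (simp add: pop_image_def)
  let ?E = "pop_inv n f"
  interpret E: bracket n ?E by (rule bracket_pop_inv)
  have no_rep: "f a \<noteq> f i" if "a < i" "0 < i" "i < f i" for a i
    using assms that by (auto simp: pop_image_def)
  have not_full: "f (- n) < n" using assms le_n[of "- n"] by (auto simp: pop_image_def)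
  have neg: "f (- k) < ?E (- k)" "next_end n ?E (- k) = f (- k) + 1"
    if k: "1 \<le> k" "k \<le> n" "f (- k) < n" for k
  proof -
    obtain b where b: "b \<le> 0" "f (- k) < f b" "?E (- k) = f b"
      using pop_inv_neg(1)[OF k(1,2)] k(3) zero by (metis order_refl)
    thus less: "f (- k) < ?E (- k)" by simp
    let ?s = "f (- k) + 1"
    have s: "1 \<le> ?s" "?s \<le> n" using nonneg[of "- k"] k by auto
    show "next_end n ?E (- k) = ?s"
    proof (rule E.next_end_eqI)
      show "max (- k) 0 < ?s" "?s \<le> n" using s k by auto
      obtain c where c: "c < ?s" "?s \<le> f c" "?E ?s = f c"
        using pop_inv_pos(1)[OF s] by auto
      have "c \<le> 0"
      proof (rule ccontr)
        assume "\<not> c \<le> 0"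
        hence "f c \<le> f (- k)" using c k by (intro laminar) auto
        thus False using c by simp
      qed
      hence "?E (- k) \<le> ?E ?s" using pop_inv_neg(3)[OF k(1,2), of c] c by simp
      moreover have "?E ?s \<le> ?E (- k)" using pop_inv_pos(2)[OF s, of b] b s by simp
      ultimately show "?E ?s = ?E (- k)" by simp
      fix z assume z: "- k < z" "0 < z" "z < ?s"
      hence "?E z \<le> f (- k)" using pop_inv_pos(2)[of z "- k"] s by simp
      thus "?E z \<noteq> ?E (- k)" using less by simp
    qed
  qed
  fix a
  consider "a < - n \<or> n < a" | "a = 0" | "1 \<le> a" "a \<le> n" | "1 \<le> - a" "- a \<le> n" by linarith
  thus "pop n ?E a = f a"
  proof cases
    case 1
    thus ?thesis using E.outside[OF 1] outside[OF 1] by (auto simp: pop_def)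
  next
    case 2
    thus ?thesis using E.zero zero by (simp add: pop_def)
  next
    case 3
    obtain b where b: "b < a" "a \<le> f b" "?E a = f b" using pop_inv_pos(1)[OF 3] by auto
    have fa: "a \<le> f a" "f a \<le> f b" using pos_ge[OF 3] laminar[of b a] b 3 by auto
    show ?thesis
    proof (cases "?E a = a")
      case True
      thus ?thesis using fa b by (simp add: pop_def)
    next
      case False
      hence less: "a < ?E a" using b by simp
      have "f a \<noteq> f b" using no_rep[of b a] b fa False 3 by force
      hence s: "1 \<le> f a + 1" "f a + 1 \<le> f b" "f a + 1 \<le> n" using fa 3 le_n[of b] by auto
      have "next_end n ?E a = f a + 1"
      proof (rule E.next_end_eqI)
        show "max a 0 < f a + 1" "f a + 1 \<le> n" using s fa 3 by auto
        obtain c where c: "c < f a + 1" "f a + 1 \<le> f c" "?E (f a + 1) = f c"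
          using pop_inv_pos(1)[of "f a + 1"] s by auto
        have "c < a"
        proof (rule ccontr)
          assume "\<not> c < a"
          hence "f c \<le> f a" using laminar[of a c] c 3 by (cases "c = a") auto
          thus False using c by simp
        qed
        hence "?E a \<le> ?E (f a + 1)" using pop_inv_pos(2)[OF 3, of c] c fa by simp
        moreover have "?E (f a + 1) \<le> ?E a" using pop_inv_pos(2)[of "f a + 1" b] b s fa by simp
        ultimately show "?E (f a + 1) = ?E a" by simp
        fix z assume z: "a < z" "0 < z" "z < f a + 1"
        hence "?E z \<le> f a" using pop_inv_pos(2)[of z a] s by simp
        thus "?E z \<noteq> ?E a" using b s by simp
      qed
      thus ?thesis using less 3 by (simp add: pop_def)
    qed
  next
    case 4
    define k where "k = - a"
    have k: "1 \<le> k" "k \<le> n" and a: "a = - k" using 4 by (auto simp: k_def)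
    show ?thesis
    proof (cases "f a = n")
      case True
      \<comment> \<open>A full row cannot grow, so \<open>pop\<close> has to leave it alone. It
        does: the tree of rows that \<open>pop\<close> shortens at column \<open>n\<close> starts at
        row \<open>f (- n) + 1\<close>, beyond all full rows, because the partition is not the full
        square.\<close>
      have En: "?E a = n" using pop_inv_neg(1)[OF k] True a le_n by (metis leD)
      have "k \<le> f (- n)" using sym[of k n] k True a n_pos by simp
      hence "\<not> next_end n ?E (- n) \<le> k"
        using neg(2)[of n] not_full n_pos by simp
      thus ?thesis using En True k a by (simp add: pop_def)
    next
      case False
      hence fk: "f (- k) < n" using le_n[of a] a by simp
      let ?l = "?E (- k)"
      have l: "f (- k) < ?l" "1 \<le> ?l" "?l \<le> n"
        using neg(1)[OF k fk] nonneg[of "- k"] E.le_n by auto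
      have "f (- ?l) < k" using sym[of k ?l] k l by auto
      hence "next_end n ?E (- ?l) \<le> k" using neg(2)[of ?l] l k by simp
      thus ?thesis using neg(2)[OF k fk] l k a by (simp add: pop_def)
    qed
  qed
qed

lemma image_pop_brackets: "pop n ` brackets n = pop_image n"
proof
  show "pop n ` brackets n \<subseteq> pop_image n"
    using bracket.pop_in_pop_image by (auto simp: brackets_def)
  show "pop_image n \<subseteq> pop n ` brackets n"
  proof
    fix f assume f: "f \<in> pop_image n"
    hence "pop_inv n f \<in> brackets n"
      using bracket.bracket_pop_inv by (auto simp: brackets_def pop_image_def)
    thus "f \<in> pop n ` brackets n" using pop_pop_inv[OF f] by (metis imageI)
  qed
qed

section \<open>Upper covers in the image of Pop\<close>

text \<open>No ancestor, row or sentinel shares the end of such a node, so a next tree with root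
  \<open>f i + 1\<close> stands behind it and can be attached as a child.\<close>

definition free_ends :: "int \<Rightarrow> (int \<Rightarrow> int) \<Rightarrow> int set" where
  "free_ends n f = {i. 1 \<le> i \<and> i \<le> n \<and> f i \<notin> f ` {..<i}}"

text \<open>The corners \<open>(k, f (- k) + 1)\<close> that can be added to the partition, one from each pair of
  mirror images.\<close>

definition outer_corners :: "int \<Rightarrow> (int \<Rightarrow> int) \<Rightarrow> int set" where
  "outer_corners n f = {k. 1 \<le> k \<and> k \<le> f (- k) + 1 \<and> f (- k) < n \<and> f (- (f (- k) + 1)) = k - 1}"

context bracket
begin

section \<open>Minimal enlargements of a bracket function\<close>

definition raise_pos :: "int \<Rightarrow> int \<Rightarrow> int" where
  "raise_pos i = f(i := f (f i + 1))"

text \<open>Adds the rectangle spanned by the trees rooted at row \<open>k\<close> and at the first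
  missing column \<open>l = f (- k) + 1\<close>, with its mirror image. A smaller piece would put a
  step of the partition inside a tree.\<close>

definition raise_neg :: "int \<Rightarrow> int \<Rightarrow> int" where
  "raise_neg k a =
     (if k \<le> - a \<and> - a \<le> f k then f (f (- k) + 1)
      else if f (- k) + 1 \<le> - a \<and> - a \<le> f (f (- k) + 1) then f k else f a)"

lemma free_endsD:
  assumes "i \<in> free_ends n f"
  shows "1 \<le> i" "i \<le> f i" "f i + 1 \<le> n" "f i + 1 \<le> f (f i + 1)"
proof -
  show i: "1 \<le> i" and "i \<le> f i" using assms pos_ge by (auto simp: free_ends_def)
  have "f 0 \<in> f ` {..<i}" using i by auto
  hence "f i \<noteq> n" using assms zero by (auto simp: free_ends_def)
  thus "f i + 1 \<le> n" using le_n[of i] by simp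
  thus "f i + 1 \<le> f (f i + 1)" using i \<open>i \<le> f i\<close> by (intro pos_ge) auto
qed

lemma bracket_raise_pos:
  assumes i: "i \<in> free_ends n f"
  shows "bracket n (raise_pos i)"
proof
  note I = free_endsD[OF i]
  let ?g = "raise_pos i"
  show "1 \<le> n" by (rule n_pos)
  show "?g 0 = n" using I zero by (simp add: raise_pos_def)
  show "j \<le> ?g j" if "1 \<le> j" "j \<le> n" for j using pos_ge[OF that] I by (simp add: raise_pos_def)
  show "?g j \<le> n" for j using le_n by (simp add: raise_pos_def)
  thus "?g (- k) \<le> n" for k .
  show "0 \<le> ?g (- k)" for k using nonneg by (simp add: raise_pos_def)
  show "l \<le> ?g (- k) \<longleftrightarrow> k \<le> ?g (- l)" if "1 \<le> k" "k \<le> n" "1 \<le> l" "l \<le> n" for k l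
    using sym[OF that] I(1) that by (auto simp: raise_pos_def)
  show "?g a = 0" if "a < - n \<or> n < a" for a
    using outside[OF that] that I by (auto simp: raise_pos_def)
  show "?g j \<le> ?g a" if j: "a < j" "0 < j" "j \<le> ?g a" for a j
  proof (cases "a = i")
    case True
    have "f j \<le> f (f i + 1)"
    proof (cases "j \<le> f i")
      case True
      hence "f j \<le> f i" using laminar[of i j] j \<open>a = i\<close> by simp
      thus ?thesis using I by simp
    next
      case False
      thus ?thesis using laminar[of "f i + 1" j] j True by (cases "j = f i + 1") (auto simp: raise_pos_def)
    qed
    thus ?thesis using True j by (simp add: raise_pos_def)
  next
    case False
    hence ga: "?g a = f a" by (simp add: raise_pos_def)
    hence fj: "f j \<le> f a" using laminar j by simp
    show ?thesis
    proof (cases "j = i")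
      case True
      have "f i \<noteq> f a" using i j True by (auto simp: free_ends_def)
      hence "f i + 1 \<le> f a" using fj True by simp
      hence "f (f i + 1) \<le> f a" using laminar[of a "f i + 1"] I j True by simp
      thus ?thesis using True ga by (simp add: raise_pos_def)
    qed (use fj ga in \<open>simp add: raise_pos_def\<close>)
  qed
qed

lemma raise_pos_le:
  assumes g: "bracket n g" "f \<le> g" and i: "i \<in> free_ends n f" and less: "f i < g i"
  shows "raise_pos i \<le> g"
proof -
  interpret g: bracket n g by (rule g)
  note I = free_endsD[OF i]
  have "f (f i + 1) \<le> g (f i + 1)" using g by (simp add: le_fun_def)
  also have "\<dots> \<le> g i" using g.laminar[of i "f i + 1"] I less by simp
  finally show ?thesis using g by (auto simp: le_fun_def raise_pos_def)
qed

lemma raise_pos_greater: "i \<in> free_ends n f \<Longrightarrow> f < raise_pos i"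
  using free_endsD[of i] by (auto simp: less_fun_def le_fun_def raise_pos_def intro: exI[of _ i])

text \<open>Column \<open>l - 1\<close> contains row \<open>k\<close>, hence by laminarity the whole
  tree of rows rooted at \<open>k\<close>, so these rows are equally long; for \<open>l = 1\<close>
  they are empty.\<close>

lemma outer_corner_block:
  assumes "1 \<le> k" "k \<le> a" "a \<le> f k" "f (- k) = l - 1" "k \<le> n"
  shows "f (- a) = l - 1"
proof -
  have a: "a \<le> n" using assms le_n[of k] by simp
  have "f (- a) \<le> l - 1" using neg_antimono[of k a] assms a by simp
  moreover have "l - 1 \<le> f (- a)"
  proof (cases "l - 1 \<ge> 1")
    case True
    have ln: "l - 1 \<le> n" using assms le_n[of "- k"] by simp
    hence "k \<le> f (- (l - 1))" using sym[of k "l - 1"] assms True by simp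
    hence "f k \<le> f (- (l - 1))" using laminar[of "- (l - 1)" k] assms True by simp
    thus ?thesis using sym[of a "l - 1"] assms a True ln by simp
  next
    case False
    thus ?thesis using nonneg[of "- a"] by simp
  qed
  ultimately show ?thesis by simp
qed

lemma outer_cornersD:
  assumes "k \<in> outer_corners n f"
  shows "1 \<le> k" "k \<le> n" "1 \<le> f (- k) + 1" "f (- k) + 1 \<le> n" "f (- (f (- k) + 1)) = k - 1"
    "k \<le> f k" "f (- k) + 1 \<le> f (f (- k) + 1)"
  using assms nonneg[of "- k"] pos_ge[of k] pos_ge[of "f (- k) + 1"] by (auto simp: outer_corners_def)

lemma raise_neg_cell_iff:
  assumes k: "k \<in> outer_corners n f"
  defines "l \<equiv> f (- k) + 1"
  shows "d \<le> raise_neg k (- a) \<longleftrightarrow>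
    d \<le> f (- a) \<or> k \<le> a \<and> a \<le> f k \<and> l \<le> d \<and> d \<le> f l \<or> l \<le> a \<and> a \<le> f l \<and> k \<le> d \<and> d \<le> f k"
proof -
  note K = outer_cornersD[OF k]
  have 1: "f (- a) = l - 1" if "k \<le> a" "a \<le> f k"
    using outer_corner_block[of k a l] that K by (simp add: l_def)
  have 2: "f (- a) = k - 1" if "l \<le> a" "a \<le> f l"
    using outer_corner_block[of l a k] that K by (simp add: l_def)
  have l: "l \<le> f l" using K by (simp add: l_def)
  have rn: "raise_neg k (- a) = (if k \<le> a \<and> a \<le> f k then f l else if l \<le> a \<and> a \<le> f l then f k else f (- a))"
    by (simp add: raise_neg_def l_def)
  show ?thesis
  proof (cases "k \<le> a \<and> a \<le> f k")
    case T: True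
    show ?thesis
    proof (cases "l \<le> a \<and> a \<le> f l")
      case True
      \<comment> \<open>A row belongs to both blocks only on the diagonal, where the two trees are
        the same.\<close>
      hence "k = l" using T 1 2 by simp
      thus ?thesis unfolding rn using T 1 l by auto
    next
      case False
      thus ?thesis using T 1 l by (auto simp: rn)
    qed
  next
    case False
    thus ?thesis using 2 K by (auto simp: rn)
  qed
qed

lemma le_raise_neg: "k \<in> outer_corners n f \<Longrightarrow> f \<le> raise_neg k"
  using raise_neg_cell_iff[of k "f a" "- a" for a] by (auto simp: le_fun_def)

lemma raise_neg_nonneg: "k \<in> outer_corners n f \<Longrightarrow> 0 \<le> a \<Longrightarrow> raise_neg k a = f a"
  using outer_cornersD[of k] by (simp add: raise_neg_def)

lemma bracket_raise_neg:
  assumes k: "k \<in> outer_corners n f"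
  shows "bracket n (raise_neg k)"
proof
  note K = outer_cornersD[OF k]
  let ?g = "raise_neg k" and ?l = "f (- k) + 1"
  show "1 \<le> n" by (rule n_pos)
  show "?g 0 = n" using raise_neg_nonneg[OF k] zero by simp
  show "i \<le> ?g i" if "1 \<le> i" "i \<le> n" for i
    using that pos_ge[OF that] raise_neg_nonneg[OF k, of i] by simp
  show "?g i \<le> n" for i using le_n by (simp add: raise_neg_def)
  thus "?g (- a) \<le> n" for a .
  show "0 \<le> ?g (- a)" for a using nonneg by (simp add: raise_neg_def)
  show "d \<le> ?g (- a) \<longleftrightarrow> a \<le> ?g (- d)" if "1 \<le> a" "a \<le> n" "1 \<le> d" "d \<le> n" for a d
    unfolding raise_neg_cell_iff[OF k] using sym[OF that] by auto
  show "?g a = 0" if "a < - n \<or> n < a" for a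
    using outside[OF that] that n_pos K le_n[of k] le_n[of ?l] by (auto simp: raise_neg_def)
  show "?g j \<le> ?g a" if j: "a < j" "0 < j" "j \<le> ?g a" for a j
  proof -
    have gj: "?g j = f j" using raise_neg_nonneg[OF k] j by simp
    have "j \<le> f a \<or> (\<exists>b. 0 < b \<and> b \<le> j \<and> j \<le> f b \<and> f b \<le> ?g a)"
      using j(3) raise_neg_cell_iff[OF k, of j "- a"] K raise_neg_cell_iff[OF k, of "f ?l" "- a"]
        raise_neg_cell_iff[OF k, of "f k" "- a"] by auto
    thus ?thesis
    proof (elim disjE exE conjE)
      assume "j \<le> f a"
      hence "f j \<le> f a" using laminar j by simp
      also have "\<dots> \<le> ?g a" using le_raise_neg[OF k] by (simp add: le_fun_def)
      finally show ?thesis using gj by simp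
    next
      fix b assume b: "0 < b" "b \<le> j" "j \<le> f b" "f b \<le> ?g a"
      hence "f j \<le> f b" using laminar[of b j] by (cases "b = j") auto
      thus ?thesis using gj b by simp
    qed
  qed
qed

text \<open>One new cell in row \<open>k\<close> forces the whole rectangle: laminarity extends the
  row, symmetry passes to its last column, and laminarity extends that column.\<close>

lemma raise_neg_le:
  assumes g: "bracket n g" "f \<le> g" and k: "k \<in> outer_corners n f" and less: "f (- k) < g (- k)"
  shows "raise_neg k \<le> g"
proof -
  interpret g: bracket n g by (rule g)
  note K = outer_cornersD[OF k]
  let ?l = "f (- k) + 1"
  have ge: "f a \<le> g a" for a using g by (simp add: le_fun_def)
  have fl: "f k \<le> n" "f ?l \<le> n" by (rule le_n)+
  have "f ?l \<le> g (- k)"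
    using g.laminar[of "- k" ?l] K less ge[of ?l] by simp
  hence "k \<le> g (- f ?l)" using g.sym[of k "f ?l"] K fl by simp
  hence 1: "f k \<le> g (- f ?l)"
    using g.laminar[of "- f ?l" k] K ge[of k] by simp
  hence 2: "f ?l \<le> g (- f k)" using g.sym[of "f k" "f ?l"] K fl by simp
  show ?thesis
    unfolding le_fun_def
  proof
    fix a
    show "raise_neg k a \<le> g a"
    proof (cases "k \<le> - a \<and> - a \<le> f k")
      case True
      thus ?thesis using 2 g.neg_antimono[of "- a" "f k"] K fl by (simp add: raise_neg_def)
    next
      case False
      show ?thesis
      proof (cases "?l \<le> - a \<and> - a \<le> f ?l")
        case True
        hence "f k \<le> g a" using 1 g.neg_antimono[of "- a" "f ?l"] K fl by simp
        thus ?thesis unfolding raise_neg_def if_not_P[OF False] if_P[OF True] .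
      next
        case F: False
        show ?thesis unfolding raise_neg_def if_not_P[OF False] if_not_P[OF F] by (rule ge)
      qed
    qed
  qed
qed

lemma raise_neg_self: "k \<in> outer_corners n f \<Longrightarrow> f (- k) < raise_neg k (- k)"
  using outer_cornersD[of k] by (simp add: raise_neg_def)

lemma raise_neg_greater: "k \<in> outer_corners n f \<Longrightarrow> f < raise_neg k"
  using raise_neg_self[of k] le_raise_neg[of k] unfolding less_fun_def le_fun_def
  by (meson leD)

text \<open>A new cell \<open>(k, l)\<close> with \<open>k + l\<close> minimal has its left and
  upper neighbours in the old partition or on the border, so it is an outer corner; if
  \<open>k > l\<close>, its mirror image is taken.\<close>

lemma outer_corner_exists:
  assumes g: "bracket n g" "f \<le> g" and a: "a < 0" "f a < g a"
  shows "\<exists>k\<in>outer_corners n f. f (- k) < g (- k)"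
proof -
  interpret g: bracket n g by (rule g)
  define P where "P = (\<lambda>(k, l). 1 \<le> k \<and> k \<le> n \<and> 1 \<le> l \<and> l \<le> n \<and> f (- k) < l \<and> l \<le> g (- k))"
  have "- n \<le> a" using g.in_range[of a] a nonneg[of a] by simp
  hence "P (- a, g a)" using a nonneg[of a] g.le_n[of a] by (simp add: P_def)
  then obtain kl where kl: "P kl" and min: "\<And>y. P y \<Longrightarrow> nat (fst kl + snd kl) \<le> nat (fst y + snd y)"
    using ex_has_least_nat[of P "(- a, g a)" "\<lambda>p. nat (fst p + snd p)"] by blast
  obtain k l where "kl = (k, l)" by (cases kl)
  with kl min have k: "1 \<le> k" "k \<le> n" and l: "1 \<le> l" "l \<le> n" "f (- k) < l" "l \<le> g (- k)"
    and min: "\<And>k' l'. P (k', l') \<Longrightarrow> nat (k + l) \<le> nat (k' + l')"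
    by (auto simp: P_def)
  have 1: "f (- k) = l - 1"
  proof (rule ccontr)
    assume "f (- k) \<noteq> l - 1"
    hence "P (k, l - 1)" using k l nonneg[of "- k"] by (auto simp: P_def)
    from min[OF this] show False using k l by simp
  qed
  have lk: "f (- l) < k" using sym[of k l] k l by simp
  have 2: "f (- l) = k - 1"
  proof (rule ccontr)
    assume "f (- l) \<noteq> k - 1"
    hence less: "f (- l) < k - 1" "1 \<le> k - 1" using lk nonneg[of "- l"] by auto
    hence "f (- (k - 1)) < l" using sym[of "k - 1" l] k l by simp
    moreover have "l \<le> g (- (k - 1))" using g.neg_antimono[of "k - 1" k] k l less by simp
    ultimately have "P (k - 1, l)" using k l less by (auto simp: P_def)
    from min[OF this] show False using k l by simp
  qed
  show ?thesis
  proof (cases "k \<le> l")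
    case True
    hence "k \<in> outer_corners n f" using k l 1 2 by (simp add: outer_corners_def)
    moreover have "f (- k) < g (- k)" using l by simp
    ultimately show ?thesis by blast
  next
    case False
    hence "l \<in> outer_corners n f" using k l 1 2 by (simp add: outer_corners_def)
    moreover have "k \<le> g (- l)" using g.sym[of k l] k l by simp
    ultimately show ?thesis using lk by force
  qed
qed

text \<open>The image condition enters when only the forest grows. A raised node that is not free
  shares its end with some \<open>a\<close> to its left, so it is a leaf and \<open>a\<close> is
  raised too; then \<open>a\<close> is an inner node, and inner nodes are free.\<close>

lemma above_raise:
  assumes im: "f \<in> pop_image n" and g: "bracket n g" "f < g"
  shows "(\<exists>i\<in>free_ends n f. raise_pos i \<le> g) \<or> (\<exists>k\<in>outer_corners n f. raise_neg k \<le> g)"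
proof (cases "\<exists>a<0. f a < g a")
  case True
  thus ?thesis using outer_corner_exists[OF g(1)] raise_neg_le[OF g(1)] g(2) by (meson less_imp_le)
next
  case False
  interpret g: bracket n g by (rule g)
  have fg: "f \<le> g" using g by simp
  hence le: "f a \<le> g a" for a by (simp add: le_fun_def)
  have "\<not> g \<le> f" using g by auto
  then obtain i where i: "f i < g i" by (auto simp: le_fun_def not_le)
  hence i0: "0 < i" "i \<le> n" using False zero g.zero g.in_range[of i] nonneg[of i]
    by (cases "i = 0"; force)+
  show ?thesis
  proof (cases "i \<in> free_ends n f")
    case True
    thus ?thesis using raise_pos_le[OF g(1) fg] i by blast
  next
    case False
    then obtain a where a: "a < i" "f a = f i" using i0 by (auto simp: free_ends_def)
    hence fi: "f i = i" using im i0 pos_ge[of i] by (force simp: pop_image_def)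
    have "f a < g a"
      using g.laminar[of a i] a fi i i0 le[of a] by simp
    moreover from this have "0 < a" "a < f a" "a \<le> n"
      using \<open>\<not> (\<exists>a<0. f a < g a)\<close> zero g.zero a fi i0 by (cases "a = 0"; force)+
    moreover from this have "a \<in> free_ends n f"
      using im by (force simp: pop_image_def free_ends_def)
    ultimately show ?thesis using raise_pos_le[OF g(1) fg] by blast
  qed
qed

lemma covers_raise_pos:
  assumes i: "i \<in> free_ends n f"
  shows "covers_in (brackets n) f (raise_pos i)"
proof -
  have False if g: "bracket n g" "f < g" "g < raise_pos i" for g
  proof -
    have fg: "f \<le> g" and gr: "g \<le> raise_pos i" using g by auto
    have "\<not> g \<le> f" using g by auto
    then obtain a where "f a < g a" by (auto simp: le_fun_def not_le)
    moreover have "g a \<le> raise_pos i a" using gr by (simp add: le_fun_def)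
    ultimately have "f i < g i" by (cases "a = i") (auto simp: raise_pos_def)
    hence "raise_pos i \<le> g" using raise_pos_le[OF g(1) fg i] by simp
    thus False using g by simp
  qed
  thus ?thesis using bracket_raise_pos[OF i] raise_pos_greater[OF i] bracket_axioms
    by (auto simp: covers_in_def brackets_def)
qed

lemma covers_raise_neg:
  assumes k: "k \<in> outer_corners n f"
  shows "covers_in (brackets n) f (raise_neg k)"
proof -
  note K = outer_cornersD[OF k]
  let ?l = "f (- k) + 1"
  have False if g: "bracket n g" "f < g" "g < raise_neg k" for g
  proof -
    interpret g: bracket n g by (rule g)
    have fg: "f \<le> g" and gr: "g \<le> raise_neg k" using g by auto
    have "\<not> g \<le> f" using g by auto
    then obtain a where a: "f a < g a" by (auto simp: le_fun_def not_le)
    have "g a \<le> raise_neg k a" using gr by (simp add: le_fun_def)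
    with a have "k \<le> - a \<and> - a \<le> f k \<and> ?l \<le> g a \<or> ?l \<le> - a \<and> - a \<le> f ?l \<and> k \<le> g a"
      using raise_neg_cell_iff[OF k, of "g a" "- a"] by auto
    hence "?l \<le> g (- k)"
    proof (elim disjE conjE)
      assume A: "k \<le> - a" "- a \<le> f k" "?l \<le> g a"
      thus ?thesis using g.neg_antimono[of k "- a"] K le_n[of k] by simp
    next
      assume A: "?l \<le> - a" "- a \<le> f ?l" "k \<le> g a"
      hence "k \<le> g (- ?l)" using g.neg_antimono[of ?l "- a"] K le_n[of ?l] by simp
      thus ?thesis using g.sym[of k ?l] K by simp
    qed
    hence "raise_neg k \<le> g" using raise_neg_le[OF g(1) fg k] by simp
    thus False using g by simp
  qed
  thus ?thesis using bracket_raise_neg[OF k] raise_neg_greater[OF k] bracket_axioms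
    by (auto simp: covers_in_def brackets_def)
qed

lemma upper_covers_eq:
  assumes im: "f \<in> pop_image n"
  shows "{g. covers_in (brackets n) f g} = raise_pos ` free_ends n f \<union> raise_neg ` outer_corners n f"
proof (intro Set.set_eqI iffI)
  fix g assume "g \<in> raise_pos ` free_ends n f \<union> raise_neg ` outer_corners n f"
  thus "g \<in> {g. covers_in (brackets n) f g}" using covers_raise_pos covers_raise_neg by auto
next
  fix g assume "g \<in> {g. covers_in (brackets n) f g}"
  hence g: "covers_in (brackets n) f g" by simp
  hence "bracket n g" "f < g" by (auto simp: covers_in_def brackets_def)
  then obtain h where h: "h \<le> g" "h \<in> raise_pos ` free_ends n f \<union> raise_neg ` outer_corners n f"
    using above_raise[OF im] by blast
  moreover from this have "covers_in (brackets n) f h"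
    using covers_raise_pos covers_raise_neg by auto
  ultimately have "h = g" using g unfolding covers_in_def by (metis order_le_less)
  thus "g \<in> raise_pos ` free_ends n f \<union> raise_neg ` outer_corners n f" using h by simp
qed

lemma finite_free_ends: "finite (free_ends n f)"
  by (rule finite_subset[of _ "{1..n}"]) (auto simp: free_ends_def)

lemma finite_outer_corners: "finite (outer_corners n f)"
  by (rule finite_subset[of _ "{1..n}"]) (auto simp: outer_corners_def)

lemma card_upper_covers:
  assumes im: "f \<in> pop_image n"
  shows "card {g. covers_in (brackets n) f g} = card (free_ends n f) + card (outer_corners n f)"
proof -
  have changed: "raise_pos i j \<noteq> f j \<longleftrightarrow> i = j" if "i \<in> free_ends n f" for i j
    using free_endsD[OF that] by (auto simp: raise_pos_def)
  have "inj_on raise_pos (free_ends n f)"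
    using changed by (intro inj_onI) metis
  moreover have "inj_on raise_neg (outer_corners n f)"
  proof (rule inj_onI, rule ccontr)
    have False if "k \<in> outer_corners n f" "k' \<in> outer_corners n f" "k < k'"
      "raise_neg k = raise_neg k'" for k k'
    proof -
      have "raise_neg k (- k) \<noteq> f (- k)" using raise_neg_self[OF that(1)] by simp
      hence "raise_neg k' (- k) \<noteq> f (- k)" using that by simp
      \<comment> \<open>Choosing \<open>k <= l\<close> in each mirror pair makes \<open>k\<close>
        the first row that \<open>raise_neg k\<close> changes.\<close>
      moreover have "k' \<le> f (- k') + 1" using that by (simp add: outer_corners_def)
      ultimately show False using \<open>k < k'\<close> by (simp add: raise_neg_def)
    qed
    thus "k \<in> outer_corners n f \<Longrightarrow> k' \<in> outer_corners n f \<Longrightarrow> raise_neg k = raise_neg k' \<Longrightarrow> k \<noteq> k' \<Longrightarrow> False"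
      for k k' by (metis linorder_cases)
  qed
  moreover have "raise_pos ` free_ends n f \<inter> raise_neg ` outer_corners n f = {}"
  proof -
    have "raise_pos i \<noteq> raise_neg k" if "i \<in> free_ends n f" "k \<in> outer_corners n f" for i k
      using changed[OF that(1), of i] raise_neg_nonneg[OF that(2), of i] free_endsD(1)[OF that(1)]
      by (metis le_less_trans less_imp_le zero_less_one_class.zero_le_one order_trans)
    thus ?thesis by blast
  qed
  ultimately show ?thesis
    unfolding upper_covers_eq[OF im]
    by (subst card_Un_disjoint) (simp_all add: finite_free_ends finite_outer_corners card_image)
qed

end

section \<open>Motzkin paths and the image of Pop\<close>

text \<open>The word is read from right to left, starting at node \<open>n - 1\<close>. The stack holds
  the leaves waiting for a parent whose last child they are; those left at the end are the cuts.\<close>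

fun stack :: "int \<Rightarrow> step list \<Rightarrow> int list" where
  "stack n [] = [n]"
| "stack n (Up # w) = (n - 1 - int (length w)) # stack n w"
| "stack n (Level # w) = stack n w"
| "stack n (Down # w) = tl (stack n w)"

fun ends :: "int \<Rightarrow> step list \<Rightarrow> int \<Rightarrow> int" where
  "ends n [] = (\<lambda>i. i)"
| "ends n (Up # w) = ends n w"
| "ends n (Level # w) = ends n w"
| "ends n (Down # w) = (ends n w)(n - 1 - int (length w) := hd (stack n w))"

lemma length_stack: "motzkin k w \<Longrightarrow> length (stack n w) = Suc k"
  by (induction k w rule: motzkin.induct) auto

definition step_of :: "(int \<Rightarrow> int) \<Rightarrow> int \<Rightarrow> step" where
  "step_of f i = (if i < f i then Down else if f i \<in> f ` {..<i} then Up else Level)"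

text \<open>State after reading the nodes \<open>i..n\<close>: \<open>e\<close> is the forest on
  them and \<open>st\<close> holds the ends that something further left has yet to claim, with the
  sentinel \<open>n\<close> at the bottom. \<open>no_rep\<close> and \<open>no_cut\<close> carry the
  image condition: the end of an inner node is claimed by nobody to its left.\<close>

locale stack_machine =
  fixes n :: int and i :: int and e :: "int \<Rightarrow> int" and st :: "int list"
  assumes le: "i \<le> n"
    and sorted: "sorted_wrt (<) st"
    and n_in: "n \<in> set st"
    and range: "c \<in> set st \<Longrightarrow> i \<le> c \<and> c \<le> n"
    and ends: "i \<le> j \<Longrightarrow> j \<le> n \<Longrightarrow> j \<le> e j \<and> e j \<le> n"
    and idle: "j < i \<or> n < j \<Longrightarrow> e j = j"
    and laminar: "i \<le> a \<Longrightarrow> a < j \<Longrightarrow> j \<le> e a \<Longrightarrow> e j \<le> e a"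
    and cut: "c \<in> set st \<Longrightarrow> i \<le> j \<Longrightarrow> j \<le> c \<Longrightarrow> e j \<le> c"
    and no_rep: "i \<le> a \<Longrightarrow> a < j \<Longrightarrow> j < e j \<Longrightarrow> e a \<noteq> e j"
    and no_cut: "j < e j \<Longrightarrow> e j \<notin> set st"

lemma stack_machine_build:
  assumes "motzkin k w" "int (length w) < n"
  shows "stack_machine n (n - int (length w)) (ends n w) (stack n w)"
  using assms
proof (induction w arbitrary: k)
  case Nil
  show ?case by unfold_locales auto
next
  case (Cons s w)
  obtain l where l: "motzkin l w" "s = Down \<longrightarrow> 0 < l"
    using Cons.prems by (cases s) auto
  let ?i = "n - 1 - int (length w)"
  interpret stack_machine n "?i + 1" "ends n w" "stack n w"
    using Cons.IH[OF l(1)] Cons.prems by simp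
  have "stack_machine n ?i (ends n (s # w)) (stack n (s # w))"
  proof (cases s)
    case Level
    have e: "ends n w ?i = ?i" using idle by simp
    show ?thesis unfolding Level stack.simps ends.simps
    proof
      fix a j
      show "?i \<le> n" using le by simp
      show "sorted_wrt (<) (stack n w)" "n \<in> set (stack n w)" using sorted n_in .
      show "?i \<le> c \<and> c \<le> n" if "c \<in> set (stack n w)" for c using range[OF that] by simp
      show "j \<le> ends n w j \<and> ends n w j \<le> n" if "?i \<le> j" "j \<le> n"
        using ends[of j] that e by (cases "j = ?i") auto
      show "ends n w j = j" if "j < ?i \<or> n < j" using idle that by auto
      show "ends n w j \<le> ends n w a" if "?i \<le> a" "a < j" "j \<le> ends n w a"
        using laminar[of a j] that e by (cases "a = ?i") auto
      show "ends n w j \<le> c" if "c \<in> set (stack n w)" "?i \<le> j" "j \<le> c" for c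
        using cut[of c j] that e by (cases "j = ?i") auto
      show "ends n w a \<noteq> ends n w j" if "?i \<le> a" "a < j" "j < ends n w j"
        using no_rep[of a j] that e by (cases "a = ?i") auto
      show "ends n w j \<notin> set (stack n w)" if "j < ends n w j" using no_cut[OF that] .
    qed
  next
    case Up
    have e: "ends n w ?i = ?i" using idle by simp
    show ?thesis unfolding Up stack.simps ends.simps
    proof
      fix a j
      show "?i \<le> n" using le by simp
      show "sorted_wrt (<) (?i # stack n w)" using sorted range by force
      show "n \<in> set (?i # stack n w)" using n_in by simp
      show "?i \<le> c \<and> c \<le> n" if "c \<in> set (?i # stack n w)" for c using range[of c] that le by auto
      show "j \<le> ends n w j \<and> ends n w j \<le> n" if "?i \<le> j" "j \<le> n"
        using ends[of j] that e by (cases "j = ?i") auto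
      show "ends n w j = j" if "j < ?i \<or> n < j" using idle that by auto
      show "ends n w j \<le> ends n w a" if "?i \<le> a" "a < j" "j \<le> ends n w a"
        using laminar[of a j] that e by (cases "a = ?i") auto
      show "ends n w j \<le> c" if "c \<in> set (?i # stack n w)" "?i \<le> j" "j \<le> c" for c
        using cut[of c j] that e by (cases "j = ?i") auto
      show "ends n w a \<noteq> ends n w j" if "?i \<le> a" "a < j" "j < ends n w j"
        using no_rep[of a j] that e by (cases "a = ?i") auto
      show "ends n w j \<notin> set (?i # stack n w)" if "j < ends n w j"
        using no_cut[OF that] idle[of j] ends[of j] that by force
    qed
  next
    case Down
    \<comment> \<open>Positive height means at least two entries, so the sentinel \<open>n\<close>
      is never taken off.\<close>
    then obtain c t where st: "stack n w = c # t" "t \<noteq> []"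
      using l length_stack[OF l(1), of n] by (cases "stack n w") auto
    have ct: "c \<in> set (stack n w)" "c < d" if "d \<in> set t" for d
      using st sorted that by auto
    obtain d where "d \<in> set t" using st by (cases t) auto
    hence c: "?i < c" "c < n" using range[of c] range[of d] ct[of d] st by auto
    let ?e = "(ends n w)(?i := c)"
    show ?thesis unfolding Down stack.simps ends.simps st list.sel
    proof
      fix a j
      show "?i \<le> n" using le by simp
      show "sorted_wrt (<) t" using sorted st by simp
      show "n \<in> set t" using n_in st c by auto
      show "?i \<le> d \<and> d \<le> n" if "d \<in> set t" for d using range[of d] that st by simp
      show "j \<le> ?e j \<and> ?e j \<le> n" if "?i \<le> j" "j \<le> n"
        using ends[of j] that c by (cases "j = ?i") auto
      show "?e j = j" if "j < ?i \<or> n < j" using idle that le by auto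
      show "?e j \<le> ?e a" if "?i \<le> a" "a < j" "j \<le> ?e a"
        using laminar[of a j] cut[of c j] that st by (cases "a = ?i") auto
      show "?e j \<le> d" if "d \<in> set t" "?i \<le> j" "j \<le> d" for d
        using cut[of d j] that ct[of d] st by (cases "j = ?i") auto
      show "?e a \<noteq> ?e j" if "?i \<le> a" "a < j" "j < ?e j"
        using no_rep[of a j] no_cut[of j] that st by (cases "a = ?i") auto
      show "?e j \<notin> set t" if "j < ?e j"
        using no_cut[of j] that st ct[of c] by (cases "j = ?i") auto
    qed
  qed
  thus ?case by (simp add: algebra_simps)
qed

text \<open>The letters are recovered from the final state: a pushed node is either still on the
  stack or has become, through a down step, the end of a smaller node.\<close>

lemma step_build:
  assumes "motzkin k w" "int (length w) < n" "p < length w"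
  defines "i \<equiv> n - int (length w)"
  defines "j \<equiv> i + int p"
  shows "w ! p = (if j < ends n w j then Down
    else if j \<in> set (stack n w) \<or> (\<exists>a. i \<le> a \<and> a < j \<and> ends n w a = j) then Up else Level)"
  using assms(1-3) unfolding i_def j_def
proof (induction w arbitrary: k p)
  case (Cons s w)
  obtain l where l: "motzkin l w" "s = Down \<longrightarrow> 0 < l"
    using Cons.prems by (cases s) auto
  let ?i = "n - 1 - int (length w)"
  have len: "int (length w) < n" using Cons.prems by simp
  interpret stack_machine n "?i + 1" "ends n w" "stack n w"
    using stack_machine_build[OF l(1) len] by simp
  have e: "ends n w ?i = ?i" using idle by simp
  have eq: "n - int (length (s # w)) = ?i" by simp
  show ?case
  proof (cases p)
    case 0
    have "?i \<notin> set (stack n w)" using range[of ?i] by auto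
    moreover have "?i < hd (stack n w)"
      using range[of "hd (stack n w)"] n_in by (cases "stack n w") auto
    ultimately show ?thesis
      unfolding eq using 0 e by (cases s) auto
  next
    case (Suc q)
    define j where "j = ?i + 1 + int q"
    have j: "?i + int p = j" "n - int (length w) + int q = j" "?i < j" using Suc by (auto simp: j_def)
    have IH: "w ! q = (if j < ends n w j then Down
      else if j \<in> set (stack n w) \<or> (\<exists>a. ?i + 1 \<le> a \<and> a < j \<and> ends n w a = j) then Up else Level)"
      using Cons.IH[OF l(1) len, of q] Cons.prems Suc j by (simp add: add.commute)
    have ex: "(\<exists>a. ?i \<le> a \<and> a < j \<and> ends n (s # w) a = j) \<longleftrightarrow>
      ends n (s # w) ?i = j \<or> (\<exists>a. ?i + 1 \<le> a \<and> a < j \<and> ends n w a = j)"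
    proof -
      have same: "ends n (s # w) a = ends n w a" if "a \<noteq> ?i" for a
        using that by (cases s) auto
      show ?thesis
      proof (intro iffI; elim exE disjE conjE)
        fix a assume a: "?i \<le> a" "a < j" "ends n (s # w) a = j"
        show "ends n (s # w) ?i = j \<or> (\<exists>a. ?i + 1 \<le> a \<and> a < j \<and> ends n w a = j)"
        proof (cases "a = ?i")
          case False
          with a same[of a] have "?i + 1 \<le> a \<and> a < j \<and> ends n w a = j" by simp
          thus ?thesis by (intro disjI2 exI)
        qed (use a in simp)
      next
        assume "ends n (s # w) ?i = j"
        thus "\<exists>a. ?i \<le> a \<and> a < j \<and> ends n (s # w) a = j" using j(3) by (intro exI[of _ ?i] conjI) simp_all
      next
        fix a assume a: "?i + 1 \<le> a" "a < j" "ends n w a = j"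
        with same[of a] have "?i \<le> a \<and> a < j \<and> ends n (s # w) a = j" by simp
        thus "\<exists>a. ?i \<le> a \<and> a < j \<and> ends n (s # w) a = j" by (rule exI)
      qed
    qed
    have "j < ends n (s # w) j \<longleftrightarrow> j < ends n w j"
      using j(3) by (cases s) auto
    \<comment> \<open>A new letter moves \<open>j\<close> at most from the stack to the end of the
      new node, which leaves the disjunction unchanged.\<close>
    moreover have "j \<in> set (stack n (s # w)) \<or> ends n (s # w) ?i = j \<longleftrightarrow> j \<in> set (stack n w)"
      using j(3) e n_in by (cases s; cases "stack n w") auto
    ultimately show ?thesis
      unfolding eq j(1) ex using IH Suc by auto
  qed
qed simp

text \<open>Turns comparisons with entries of the staircase into comparisons of ranks.\<close>

lemma le_nth_iff_filter:
  fixes xs :: "int list"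
  assumes "sorted_wrt (<) xs" "r < length xs"
  shows "l \<le> xs ! r \<longleftrightarrow> length (filter (\<lambda>c. c < l) xs) \<le> r"
  using assms
proof (induction xs arbitrary: r)
  case (Cons x xs)
  show ?case
  proof (cases "x < l")
    case True
    with Cons show ?thesis by (cases r) auto
  next
    case False
    hence "filter (\<lambda>c. c < l) (x # xs) = []"
      using Cons.prems by (force simp: filter_empty_conv)
    moreover have "x \<le> (x # xs) ! r"
    proof (cases r)
      case (Suc m)
      hence "xs ! m \<in> set xs" using Cons.prems by simp
      hence "x < xs ! m" using Cons.prems(1) by simp
      thus ?thesis using Suc by simp
    qed simp
    ultimately show ?thesis using False by simp
  qed
qed simp

text \<open>The bit \<open>d\<close> tells whether the partition with the given cuts has \<open>n\<close> nonzero rows.\<close>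

definition staircase :: "int list \<Rightarrow> bool \<Rightarrow> int \<Rightarrow> int" where
  "staircase st d k = (0 # st) ! (length st + of_bool d - 1 - length (filter (\<lambda>c. c < k) st))"

definition assemble :: "int \<Rightarrow> (int \<Rightarrow> int) \<Rightarrow> int list \<Rightarrow> bool \<Rightarrow> int \<Rightarrow> int" where
  "assemble n e st d a =
     (if a < - n \<or> n < a then 0 else if 0 < a then e a else if a = 0 then n else staircase st d (- a))"

text \<open>All nodes have been read. With \<open>d\<close> and \<open>n\<close> as the only cut,
  the staircase would be the full square; \<open>nontrivial\<close> excludes this.\<close>

locale full_stack_machine = stack_machine n 1 e st for n e st +
  fixes d :: bool
  assumes nontrivial: "d \<Longrightarrow> length st \<noteq> 1"
begin

abbreviation "M \<equiv> length st"
abbreviation "cs \<equiv> 0 # st"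
abbreviation "rank k \<equiv> length (filter (\<lambda>c. c < k) st)"
abbreviation "f \<equiv> assemble n e st d"

lemma M_pos: "0 < M" using n_in by (cases st) auto

lemma sorted_cs: "sorted_wrt (<) cs"
  using sorted range by force

lemma rank_less: "k \<le> n \<Longrightarrow> rank k < M"
  using n_in length_filter_less[of n st "\<lambda>c. c < k"] by auto

lemma rank_cs: "1 \<le> l \<Longrightarrow> length (filter (\<lambda>c. c < l) cs) = Suc (rank l)"
  by simp

text \<open>The diagram consists of the cells whose ranks have a bounded sum, so it is visibly
  symmetric; this is why the index in \<open>staircase\<close> subtracts the rank.\<close>

lemma staircase_ge_iff:
  assumes "1 \<le> k" "k \<le> n" "1 \<le> l"
  shows "l \<le> staircase st d k \<longleftrightarrow> rank k + rank l + 2 \<le> M + of_bool d"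
proof -
  have "l \<le> staircase st d k \<longleftrightarrow> Suc (rank l) \<le> M + of_bool d - 1 - rank k"
  proof -
    have "M + of_bool d - 1 - rank k < length cs" using M_pos by (cases d; simp; linarith)
    thus ?thesis unfolding staircase_def by (simp only: le_nth_iff_filter[OF sorted_cs] rank_cs[OF assms(3)])
  qed
  thus ?thesis using rank_less[of k] assms by auto
qed

lemma staircase_in: "1 \<le> k \<Longrightarrow> staircase st d k \<in> set cs"
  unfolding staircase_def by (rule nth_mem) auto

lemma cs_le: "c \<in> set cs \<Longrightarrow> 0 \<le> c \<and> c \<le> n"
  using range[of c] le by auto

lemma nth_cs_inj: "r \<le> M \<Longrightarrow> s \<le> M \<Longrightarrow> cs ! r \<le> cs ! s \<longleftrightarrow> r \<le> s"
  using sorted_wrt_nth_less[OF sorted_cs, of r s] sorted_wrt_nth_less[OF sorted_cs, of s r]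
  by (cases r s rule: linorder_cases) auto

lemma last_cs: "cs ! M = n"
proof -
  obtain r where r: "r < length cs" "cs ! r = n"
    using n_in by (metis in_set_conv_nth list.set_intros(2))
  have "cs ! M \<le> n" using cs_le[of "cs ! M"] nth_mem[of M cs] by auto
  with r nth_cs_inj[of M r] have "M \<le> r" by simp
  hence "r = M" using r by simp
  thus ?thesis using r by simp
qed

lemma rank_Suc_nth:
  assumes "r < M"
  shows "rank (cs ! r + 1) = r"
proof -
  have r: "0 \<le> cs ! r" using cs_le[of "cs ! r"] nth_mem[of r cs] assms by simp
  have "cs ! r + 1 \<le> cs ! Suc r"
    using sorted_wrt_nth_less[OF sorted_cs, of r "Suc r"] assms by simp
  hence "Suc (rank (cs ! r + 1)) \<le> Suc r"
    using le_nth_iff_filter[OF sorted_cs, of "Suc r" "cs ! r + 1"] assms r by simp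
  moreover have "\<not> cs ! r + 1 \<le> cs ! r" by simp
  hence "\<not> Suc (rank (cs ! r + 1)) \<le> r"
    using le_nth_iff_filter[OF sorted_cs, of r "cs ! r + 1"] assms r by simp
  ultimately show ?thesis by simp
qed

lemma f_pos: "1 \<le> a \<Longrightarrow> a \<le> n \<Longrightarrow> f a = e a"
  by (simp add: assemble_def)

lemma f_neg: "1 \<le> k \<Longrightarrow> k \<le> n \<Longrightarrow> f (- k) = staircase st d k"
  by (simp add: assemble_def)

lemma f_zero: "f 0 = n"
  using le by (simp add: assemble_def)

lemma f_outside: "a < - n \<or> n < a \<Longrightarrow> f a = 0"
  by (simp add: assemble_def)

lemma f_nonpos_in: "a \<le> 0 \<Longrightarrow> f a \<in> set cs"
  using staircase_in[of "- a"] n_in by (auto simp: assemble_def)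

lemma bracket_f: "bracket n f"
proof
  show "1 \<le> n" by (rule le)
  show "f 0 = n" by (rule f_zero)
  show "i \<le> f i" "f i \<le> n" if "1 \<le> i" "i \<le> n" for i using ends[OF that] f_pos[OF that] by auto
  show "0 \<le> f (- k)" "f (- k) \<le> n" if "1 \<le> k" for k
    using cs_le[OF f_nonpos_in[of "- k"]] that by auto
  show "l \<le> f (- k) \<longleftrightarrow> k \<le> f (- l)" if "1 \<le> k" "k \<le> n" "1 \<le> l" "l \<le> n" for k l
    using that by (simp add: f_neg staircase_ge_iff add.commute)
  show "f a = 0" if "a < - n \<or> n < a" for a using f_outside[OF that] .
  show "f j \<le> f a" if j: "a < j" "0 < j" "j \<le> f a" for a j
  proof (cases "0 < a")
    case True
    have "a \<le> n" using j f_outside[of a] by (cases "n < a") auto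
    hence fa: "f a = e a" using True f_pos by simp
    hence "j \<le> n" using ends[of a] True \<open>a \<le> n\<close> j by simp
    thus ?thesis using laminar[of a j] fa f_pos[of j] True j by simp
  next
    case False
    hence "f a \<in> set cs" using f_nonpos_in by simp
    hence "f a \<in> set st" using j by auto
    thus ?thesis using cut[of "f a" j] range[of "f a"] f_pos[of j] j by simp
  qed
qed

lemma neg_n: "f (- n) = cs ! of_bool d"
proof -
  have "cs ! (M - 1) < n"
    using sorted_wrt_nth_less[OF sorted_cs, of "M - 1" M] last_cs M_pos by simp
  hence "\<not> rank n \<le> M - 2" if "M \<ge> 2"
  proof -
    have "\<not> n \<le> cs ! (M - 1)" using \<open>cs ! (M - 1) < n\<close> by simp
    hence "\<not> Suc (rank n) \<le> M - 1"
      using le_nth_iff_filter[OF sorted_cs, of "M - 1" n] le by simp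
    thus ?thesis using that by simp
  qed
  hence "rank n = M - 1" using rank_less[of n] M_pos by (cases "M \<ge> 2"; linarith)
  thus ?thesis using f_neg[of n] le M_pos by (simp add: staircase_def)
qed

lemma f_neg_n_pos: "0 < f (- n) \<longleftrightarrow> d"
  using neg_n range[of "st ! 0"] nth_mem[of 0 st] M_pos by (cases d) auto

lemma f_in_pop_image: "f \<in> pop_image n"
proof -
  have "f (- n) \<noteq> n"
  proof
    assume "f (- n) = n"
    hence "cs ! of_bool d = cs ! M" using neg_n last_cs by simp
    hence "M \<le> of_bool d" using nth_cs_inj[of M "of_bool d"] M_pos by (cases d) auto
    thus False using nontrivial M_pos by (cases d) auto
  qed
  moreover have "f a \<noteq> f i" if i: "a < i" "0 < i" "i < f i" for a i
  proof -
    have "i \<le> n" using i f_outside[of i] by (cases "n < i") auto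
    hence fi: "f i = e i" using f_pos i by simp
    hence "e i \<notin> set st" using no_cut i by simp
    show ?thesis
    proof (cases "0 < a")
      case True
      thus ?thesis using no_rep[of a i] f_pos[of a] fi i \<open>i \<le> n\<close> by simp
    next
      case False
      hence "f a \<in> set cs" using f_nonpos_in by simp
      thus ?thesis using \<open>e i \<notin> set st\<close> fi i by auto
    qed
  qed
  ultimately show ?thesis using bracket_f by (auto simp: pop_image_def)
qed

lemma st_attained:
  assumes "c \<in> set st"
  shows "\<exists>a\<le>0. f a = c"
proof -
  obtain p where p: "p < M" "c = cs ! Suc p" using assms by (auto simp: in_set_conv_nth)
  show ?thesis
  proof (cases "Suc p = M")
    case True
    thus ?thesis using p last_cs f_zero by (intro exI[of _ 0]) simp
  next
    case False
    \<comment> \<open>A row of rank \<open>r\<close> has the entry with index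
      \<open>M + of_bool d - 1 - r\<close>; this \<open>r\<close> makes the index
      \<open>Suc p\<close>.\<close>
    define r where "r = M + of_bool d - 2 - p"
    have r: "r < M" "M + of_bool d - 1 - r = Suc p" using p False by (auto simp: r_def split: if_splits)
    have k: "1 \<le> cs ! r + 1" "cs ! r + 1 \<le> n"
      using cs_le[of "cs ! r"] nth_mem[of r cs] sorted_wrt_nth_less[OF sorted_cs, of r M] r last_cs by auto
    have "f (- (cs ! r + 1)) = c"
      unfolding f_neg[OF k] staircase_def rank_Suc_nth[OF r(1)] r(2) p(2) ..
    thus ?thesis using k by (intro exI[of _ "- (cs ! r + 1)"]) simp
  qed
qed

lemma f_attained_iff:
  assumes "1 \<le> i" "i \<le> n" "e i = i"
  shows "f i \<in> f ` {..<i} \<longleftrightarrow> i \<in> set st \<or> (\<exists>a. 1 \<le> a \<and> a < i \<and> e a = i)"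
proof
  have fi: "f i = i" using f_pos assms by simp
  assume "f i \<in> f ` {..<i}"
  then obtain a where a: "a < i" "f a = i" using fi by auto
  show "i \<in> set st \<or> (\<exists>a. 1 \<le> a \<and> a < i \<and> e a = i)"
  proof (cases "1 \<le> a")
    case True
    thus ?thesis using a assms f_pos[of a] by auto
  next
    case False
    thus ?thesis using f_nonpos_in[of a] a assms by auto
  qed
next
  have fi: "f i = i" using f_pos assms by simp
  assume "i \<in> set st \<or> (\<exists>a. 1 \<le> a \<and> a < i \<and> e a = i)"
  thus "f i \<in> f ` {..<i}"
  proof (elim disjE exE conjE)
    assume "i \<in> set st"
    then obtain a where "a \<le> 0" "f a = i" using st_attained by blast
    thus ?thesis using fi assms by (intro image_eqI[of _ _ a]) auto
  next
    fix a assume "1 \<le> a" "a < i" "e a = i"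
    thus ?thesis using fi f_pos[of a] assms by (intro image_eqI[of _ _ a]) auto
  qed
qed

text \<open>An outer corner sits at row \<open>cs ! r + 1\<close> and column
  \<open>cs ! s + 1\<close> with \<open>r + s = M + of_bool d - 1\<close>. The lower bound on
  \<open>r\<close> keeps the column within the square, and the upper bound is \<open>r <= s\<close>,
  which selects one of two mirror images.\<close>

lemma outer_corners_f:
  "outer_corners n f = (\<lambda>r. cs ! r + 1) ` {of_bool d..<(M + of_bool d + 1) div 2}"
proof -
  have is_corner: "cs ! r + 1 \<in> outer_corners n f \<longleftrightarrow> of_bool d \<le> r \<and> r < (M + of_bool d + 1) div 2"
    if r: "r < M" for r
  proof -
    let ?k = "cs ! r + 1" and ?s = "M + of_bool d - 1 - r"
    have k: "1 \<le> ?k" "?k \<le> n"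
      using cs_le[of "cs ! r"] nth_mem[of r cs] sorted_wrt_nth_less[OF sorted_cs, of r M] r last_cs by auto
    have fk: "f (- ?k) = cs ! ?s"
      unfolding f_neg[OF k] staircase_def rank_Suc_nth[OF r] ..
    have s: "?s \<le> M" using r by simp
    have "f (- ?k) < n \<longleftrightarrow> ?s < M"
      unfolding fk using nth_cs_inj[of M ?s] s last_cs by (simp add: not_le[symmetric])
    also have "\<dots> \<longleftrightarrow> of_bool d \<le> r" using r by (cases d) auto
    finally have 1: "f (- ?k) < n \<longleftrightarrow> of_bool d \<le> r" .
    have 2: "f (- (f (- ?k) + 1)) = cs ! r" if "of_bool d \<le> r"
    proof -
      have s': "?s < M" using r that by (cases d) auto
      have l: "1 \<le> cs ! ?s + 1" "cs ! ?s + 1 \<le> n"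
        using cs_le[of "cs ! ?s"] nth_mem[of ?s cs] sorted_wrt_nth_less[OF sorted_cs, of ?s M] s' last_cs by auto
      have "M + of_bool d - 1 - ?s = r" using r by simp
      thus ?thesis unfolding fk f_neg[OF l] staircase_def rank_Suc_nth[OF s'] by simp
    qed
    have "?k \<le> f (- ?k) + 1 \<longleftrightarrow> r \<le> ?s"
      unfolding fk using nth_cs_inj[of r ?s] r s by simp
    also have "\<dots> \<longleftrightarrow> r < (M + of_bool d + 1) div 2" using r by auto
    finally show ?thesis using 1 2 k by (auto simp: outer_corners_def)
  qed
  show ?thesis
  proof (intro Set.set_eqI iffI)
    fix k assume k: "k \<in> outer_corners n f"
    interpret bracket n f by (rule bracket_f)
    note K = outer_cornersD[OF k]
    have "k - 1 \<in> set cs" using f_nonpos_in[of "- (f (- k) + 1)"] K by simp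
    then obtain r where r: "r < length cs" "k - 1 = cs ! r" by (metis in_set_conv_nth)
    hence "r \<noteq> M" using last_cs K by auto
    hence "r < M" using r by simp
    moreover have kr: "k = cs ! r + 1" using r by simp
    ultimately show "k \<in> (\<lambda>r. cs ! r + 1) ` {of_bool d..<(M + of_bool d + 1) div 2}"
      using is_corner[of r] k by auto
  next
    fix k assume "k \<in> (\<lambda>r. cs ! r + 1) ` {of_bool d..<(M + of_bool d + 1) div 2}"
    then obtain r where r: "k = cs ! r + 1" "of_bool d \<le> r" "r < (M + of_bool d + 1) div 2" by auto
    moreover have "r < M" using r M_pos nontrivial by (cases d) auto
    ultimately show "k \<in> outer_corners n f" using is_corner by simp
  qed
qed

lemma card_outer_corners: "card (outer_corners n f) = (if d then M div 2 else (M + 1) div 2)"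
proof -
  have "inj_on (\<lambda>r. cs ! r + 1) {of_bool d..<(M + of_bool d + 1) div 2}"
  proof (rule inj_onI)
    fix r s assume "r \<in> {of_bool d..<(M + of_bool d + 1) div 2}" "s \<in> {of_bool d..<(M + of_bool d + 1) div 2}"
      and eq: "cs ! r + 1 = cs ! s + 1"
    hence "r \<le> M" "s \<le> M" using M_pos by (cases d; auto)+
    thus "r = s" using nth_cs_inj[of r s] nth_cs_inj[of s r] eq by simp
  qed
  thus ?thesis unfolding outer_corners_f by (subst card_image) (auto)
qed

end

section \<open>Encoding the image of Pop by words with a bit\<close>

definition word :: "int \<Rightarrow> (int \<Rightarrow> int) \<Rightarrow> step list" where
  "word n f = map (step_of f) [1..n - 1]"

definition decode :: "int \<Rightarrow> step list \<times> bool \<Rightarrow> int \<Rightarrow> int" where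
  "decode n p = assemble n (ends n (fst p)) (stack n (fst p)) (snd p)"

definition codes :: "int \<Rightarrow> (step list \<times> bool) set" where
  "codes n = {(w, d). int (length w) = n - 1 \<and> (\<exists>k. motzkin k w \<and> (d \<longrightarrow> k \<noteq> 0))}"

lemma full_stack_machine_codes:
  assumes "(w, d) \<in> codes n"
  shows "full_stack_machine n (ends n w) (stack n w) d"
proof -
  obtain k where k: "motzkin k w" "d \<longrightarrow> k \<noteq> 0" and len: "int (length w) = n - 1"
    using assms by (auto simp: codes_def)
  have "stack_machine n 1 (ends n w) (stack n w)"
    using stack_machine_build[OF k(1), of n] len by simp
  thus ?thesis
    using length_stack[OF k(1), of n] k(2)
    by (simp add: full_stack_machine_def full_stack_machine_axioms_def)
qed

lemma word_decode:
  assumes "(w, d) \<in> codes n"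
  shows "word n (decode n (w, d)) = w"
proof (rule nth_equalityI)
  interpret full_stack_machine n "ends n w" "stack n w" d
    by (rule full_stack_machine_codes[OF assms])
  obtain k where k: "motzkin k w" and len: "int (length w) = n - 1"
    using assms by (auto simp: codes_def)
  show "length (word n (decode n (w, d))) = length w"
    using len by (simp add: word_def)
  fix p assume "p < length (word n (decode n (w, d)))"
  hence p: "p < length w" using len by (simp add: word_def)
  define i where "i = 1 + int p"
  have i: "1 \<le> i" "i \<le> n" "i < n" using p len by (auto simp: i_def)
  have "word n (decode n (w, d)) ! p = step_of (decode n (w, d)) i"
    using p len by (simp add: word_def i_def nth_upto)
  also have "\<dots> = (if i < ends n w i then Down
      else if i \<in> set (stack n w) \<or> (\<exists>a. 1 \<le> a \<and> a < i \<and> ends n w a = i) then Up else Level)"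
  proof (cases "i < ends n w i")
    case True
    thus ?thesis using f_pos[OF i(1,2)] by (simp add: step_of_def decode_def)
  next
    case False
    hence "ends n w i = i" using ends[OF i(1,2)] by simp
    thus ?thesis using f_attained_iff[OF i(1,2)] f_pos[OF i(1,2)]
      by (simp add: step_of_def decode_def)
  qed
  also have "\<dots> = w ! p"
    using step_build[OF k _ p, of n] len by (simp add: i_def)
  finally show "word n (decode n (w, d)) ! p = w ! p" .
qed

lemma decode_in_pop_image: "(w, d) \<in> codes n \<Longrightarrow> decode n (w, d) \<in> pop_image n"
  using full_stack_machine.f_in_pop_image[OF full_stack_machine_codes] by (simp add: decode_def)

text \<open>Invariant of the reading: the stack holds exactly the ends \<open>c >= i\<close> that
  are values at some \<open>a < i\<close>. By laminarity the end of an inner node \<open>i\<close>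
  is the smallest entry for \<open>i + 1\<close>, so the down step finds it on top; by the image
  condition nothing further left needs it.\<close>

lemma build_suffix:
  assumes im: "f \<in> pop_image n" and d: "int d < n"
  defines "i \<equiv> n - int d"
  defines "w \<equiv> map (step_of f) [i..n - 1]"
  shows "(\<exists>k. motzkin k w) \<and> (\<forall>j. i \<le> j \<and> j \<le> n \<longrightarrow> ends n w j = f j) \<and>
    stack n w = sorted_list_of_set {c. i \<le> c \<and> c \<le> n \<and> (\<exists>a<i. f a = c)}"
  using d unfolding i_def w_def
proof (induction d)
  interpret bracket n f using im by (simp add: pop_image_def)
  case 0
  have "f n = n" using pos_ge[of n] pos_le[of n] n_pos by simp
  moreover have "{c. n \<le> c \<and> c \<le> n \<and> (\<exists>a<n. f a = c)} = {n}"
    using zero n_pos by (auto intro: exI[of _ 0])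
  ultimately show ?case by (auto intro: exI[of _ 0])
next
  interpret bracket n f using im by (simp add: pop_image_def)
  case (Suc d)
  define i where "i = n - int (Suc d)"
  define w where "w = map (step_of f) [i + 1..n - 1]"
  have i: "1 \<le> i" "i < n" "n - int d = i + 1" using Suc.prems by (auto simp: i_def)
  let ?C = "\<lambda>i. {c. i \<le> c \<and> c \<le> n \<and> (\<exists>a<i. f a = c)}"
  have "(\<exists>k. motzkin k w) \<and> (\<forall>j. i + 1 \<le> j \<and> j \<le> n \<longrightarrow> ends n w j = f j) \<and>
      stack n w = sorted_list_of_set (?C (i + 1))"
    using Suc.IH Suc.prems unfolding i(3) w_def by simp
  then obtain k where k: "motzkin k w" and ends: "\<And>j. i + 1 \<le> j \<Longrightarrow> j \<le> n \<Longrightarrow> ends n w j = f j"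
    and st: "stack n w = sorted_list_of_set (?C (i + 1))" by blast
  have upto: "map (step_of f) [i..n - 1] = step_of f i # w"
    using i by (simp add: w_def upto_rec1)
  have len: "n - 1 - int (length w) = i" using i by (simp add: w_def)
  interpret M: stack_machine n "i + 1" "ends n w" "stack n w"
    using stack_machine_build[OF k, of n] len i by (simp add: algebra_simps)
  have fin: "finite (?C j)" for j by (rule finite_subset[of _ "{j..n}"]) auto
  have fi: "i \<le> f i" using pos_ge i by simp
  have "(\<exists>k. motzkin k (step_of f i # w)) \<and>
    (\<forall>j. i \<le> j \<and> j \<le> n \<longrightarrow> ends n (step_of f i # w) j = f j) \<and>
    stack n (step_of f i # w) = sorted_list_of_set (?C i)"
  proof (cases "i < f i")
    case True
    hence s: "step_of f i = Down" by (simp add: step_of_def)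
    have new: "f a \<noteq> f i" if "a < i" for a
      using im True i that by (auto simp: pop_image_def)
    have mem: "f i \<in> ?C (i + 1)" using True le_n by auto
    have min: "f i \<le> c" if c: "c \<in> ?C (i + 1)" for c
    proof (rule ccontr)
      assume "\<not> f i \<le> c"
      obtain a where a: "a < i + 1" "f a = c" "i + 1 \<le> c" using c by auto
      hence "a < i" using \<open>\<not> f i \<le> c\<close> by (cases "a = i") auto
      hence "f i \<le> f a" using laminar[of a i] a i by simp
      thus False using a \<open>\<not> f i \<le> c\<close> by simp
    qed
    have Min: "Min (?C (i + 1)) = f i" by (rule Min_eqI[OF fin min mem])
    have "?C (i + 1) - {f i} = ?C i"
    proof (intro Set.set_eqI iffI)
      fix c assume c: "c \<in> ?C (i + 1) - {f i}"
      then obtain a where "a < i + 1" "f a = c" by auto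
      moreover from this c have "a \<noteq> i" by auto
      ultimately show "c \<in> ?C i" using c by (auto intro!: exI[of _ a])
    next
      fix c assume "c \<in> ?C i"
      then obtain a where a: "a < i" "f a = c" "i \<le> c" "c \<le> n" by auto
      have "c \<noteq> i" using laminar[of a i] a i True by auto
      thus "c \<in> ?C (i + 1) - {f i}" using a new by (auto intro: exI[of _ a])
    qed
    hence st': "stack n w = f i # sorted_list_of_set (?C i)"
      using sorted_list_of_set_nonempty[OF fin, of "i + 1"] mem Min st by auto
    \<comment> \<open>The sentinel always claims \<open>n\<close>, so an entry remains after the
      removal and the height before the down step is positive.\<close>
    have "n \<in> ?C i" using i zero by (auto intro: exI[of _ 0])
    hence "sorted_list_of_set (?C i) \<noteq> []" using fin by auto
    moreover have "k = length (sorted_list_of_set (?C i))"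
      using length_stack[OF k, of n] unfolding st' by (simp only: length_Cons nat.inject)
    ultimately have "0 < k" by (simp only: length_greater_0_conv not_False_eq_True)
    hence "motzkin (k - 1) (Down # w)" using k by simp
    moreover have "ends n (Down # w) j = f j" if "i \<le> j" "j \<le> n" for j
      using that ends[of j] st' len by simp
    moreover have "stack n (Down # w) = sorted_list_of_set (?C i)" using st' by simp
    ultimately show ?thesis unfolding s by blast
  next
    case False
    hence fi: "f i = i" using fi by simp
    have ends': "ends n w j = f j" if "i \<le> j" "j \<le> n" for j
      using that ends[of j] M.idle[of i] fi by (cases "j = i") auto
    have C: "?C (i + 1) = ?C i - {i}"
    proof (intro Set.set_eqI iffI)
      fix c assume c: "c \<in> ?C (i + 1)"
      then obtain a where "a < i + 1" "f a = c" by auto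
      moreover from this c fi have "a \<noteq> i" by auto
      ultimately show "c \<in> ?C i - {i}" using c by (auto intro!: exI[of _ a])
    next
      fix c assume c: "c \<in> ?C i - {i}"
      then obtain a where "a < i" "f a = c" by auto
      thus "c \<in> ?C (i + 1)" using c by (auto intro!: exI[of _ a])
    qed
    show ?thesis
    proof (cases "f i \<in> f ` {..<i}")
      case True
      hence s: "step_of f i = Up" using fi by (simp add: step_of_def)
      have mem: "i \<in> ?C i" using True fi i by (auto simp: image_iff)
      moreover have "Min (?C i) = i" using fin mem by (intro Min_eqI) auto
      ultimately have "sorted_list_of_set (?C i) = i # sorted_list_of_set (?C (i + 1))"
        using sorted_list_of_set_nonempty[OF fin, of i] C by auto
      hence "stack n (Up # w) = sorted_list_of_set (?C i)" using st len by simp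
      moreover have "motzkin (Suc k) (Up # w)" using k by simp
      ultimately show ?thesis unfolding s using ends' by auto
    next
      case False
      hence s: "step_of f i = Level" using fi by (simp add: step_of_def)
      have "i \<notin> ?C i" using False fi by auto
      hence "stack n (Level # w) = sorted_list_of_set (?C i)" using st C by simp
      moreover have "motzkin k (Level # w)" using k by simp
      ultimately show ?thesis unfolding s using ends' by auto
    qed
  qed
  thus ?case unfolding i_def[symmetric] upto .
qed

definition cuts :: "int \<Rightarrow> (int \<Rightarrow> int) \<Rightarrow> int set" where
  "cuts n f = {c. 1 \<le> c \<and> c \<le> n \<and> (\<exists>a<1. f a = c)}"

definition cut_rank :: "int \<Rightarrow> (int \<Rightarrow> int) \<Rightarrow> int \<Rightarrow> nat" where
  "cut_rank n f x = card {c \<in> cuts n f. c < x}"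

lemma build_word:
  assumes "f \<in> pop_image n"
  shows "\<exists>k. motzkin k (word n f)" "1 \<le> j \<Longrightarrow> j \<le> n \<Longrightarrow> ends n (word n f) j = f j"
    "stack n (word n f) = sorted_list_of_set (cuts n f)"
proof -
  have "1 \<le> n" using assms by (auto simp: pop_image_def dest: bracket.n_pos)
  with build_suffix[OF assms, of "nat n - 1"] show "\<exists>k. motzkin k (word n f)"
    "1 \<le> j \<Longrightarrow> j \<le> n \<Longrightarrow> ends n (word n f) j = f j"
    "stack n (word n f) = sorted_list_of_set (cuts n f)"
    by (auto simp: word_def cuts_def of_nat_diff)
qed

lemma finite_cuts [simp]: "finite (cuts n f)"
  by (rule finite_subset[of _ "{1..n}"]) (auto simp: cuts_def)

text \<open>Every cut is used on both sides of the diagonal, so passing a cut lowers the rows by exactly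
  one cut. Hence the partition is a staircase.\<close>

lemma (in bracket) cut_rank_sum:
  assumes im: "f \<in> pop_image n" and k: "1 \<le> k" "k \<le> n"
  shows "cut_rank n f (f (- k) + 1) + cut_rank n f k + 1 = card (cuts n f) + of_bool (0 < f (- n))"
proof -
  have in_cuts: "f a \<in> cuts n f" if "a \<le> 0" "f a \<noteq> 0" for a
    using that nonneg[of a] le_n[of a] by (auto simp: cuts_def intro!: exI[of _ a])
  have cutsE: "\<exists>b. 1 \<le> b \<and> b \<le> n \<and> c = f (- b)" if c: "c \<in> cuts n f" "c < n" for c
  proof -
    obtain a where a: "a < 1" "f a = c" "1 \<le> c" using c by (auto simp: cuts_def)
    moreover from this c have "a \<noteq> 0" using zero by auto
    moreover have "- n \<le> a" using in_range[of a] a by auto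
    ultimately show ?thesis by (intro exI[of _ "- a"]) auto
  qed
  have not_full: "f (- n) < n" using im le_n[of "- n"] by (auto simp: pop_image_def)
  have n_cut: "n \<in> cuts n f" using in_cuts[of 0] zero n_pos by auto
  \<comment> \<open>Downward induction from row \<open>n\<close>; the guard is there because the
    rule runs through all integers below \<open>n\<close>.\<close>
  have "1 \<le> k \<longrightarrow> cut_rank n f (f (- k) + 1) + cut_rank n f k + 1 = card (cuts n f) + of_bool (0 < f (- n))"
    using k(2)
  proof (induction k rule: int_le_induct)
    case base
    have "{c \<in> cuts n f. c < n} = cuts n f - {n}" by (auto simp: cuts_def)
    hence 1: "cut_rank n f n = card (cuts n f) - 1" using n_cut by (simp add: cut_rank_def)
    have 2: "0 < card (cuts n f)" using n_cut by (auto simp: card_gt_0_iff)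
    have "{c \<in> cuts n f. c < f (- n) + 1} = (if 0 < f (- n) then {f (- n)} else {})"
    proof -
      have "c = f (- n)" if c: "c \<in> cuts n f" "c < f (- n) + 1" for c
      proof -
        obtain b where "1 \<le> b" "b \<le> n" "c = f (- b)" using cutsE[of c] c not_full by auto
        thus ?thesis using neg_antimono[of b n] c by auto
      qed
      moreover have "0 < f (- n) \<Longrightarrow> f (- n) \<in> cuts n f" using in_cuts[of "- n"] n_pos by simp
      moreover have "0 < c" if "c \<in> cuts n f" for c using that by (simp add: cuts_def)
      ultimately show ?thesis by fastforce
    qed
    hence "cut_rank n f (f (- n) + 1) = of_bool (0 < f (- n))" by (simp add: cut_rank_def)
    thus ?case using 1 2 by simp
  next
    case (step i)
    define k where "k = i - 1"
    have "cut_rank n f (f (- k) + 1) + cut_rank n f k = cut_rank n f (f (- i) + 1) + cut_rank n f i"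
      if "1 \<le> k"
    proof -
      have k: "1 \<le> k" "k < n" "i = k + 1" "1 \<le> i" "i \<le> n" using that step.hyps by (auto simp: k_def)
      have le: "f (- i) \<le> f (- k)" using neg_antimono[of k i] k by simp
      show ?thesis
      proof (cases "k \<in> cuts n f")
        case True
        have "{c \<in> cuts n f. c < i} = insert k {c \<in> cuts n f. c < k}" using True k by auto
        hence 1: "cut_rank n f i = Suc (cut_rank n f k)" by (simp add: cut_rank_def)
        obtain b where b: "1 \<le> b" "b \<le> n" "k = f (- b)" using cutsE[OF True] k by auto
        have bk: "b \<le> f (- k)" using sym[of k b] b k by simp
        moreover have "\<not> b \<le> f (- i)" using sym[of i b] b k by simp
        ultimately have less: "f (- i) < f (- k)" by simp
        \<comment> \<open>No cut lies strictly between the lengths of the consecutive rows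
          \<open>i\<close> and \<open>k\<close>: a cut below \<open>n\<close> is the length of some
          row, either up to \<open>k\<close> or from \<open>i\<close> on.\<close>
        have "c = f (- k)" if c: "c \<in> cuts n f" "f (- i) < c" "c \<le> f (- k)" for c
        proof (cases "c < n")
          case True
          then obtain b where b: "1 \<le> b" "b \<le> n" "c = f (- b)" using cutsE c by auto
          have "\<not> i \<le> b" using neg_antimono[of i b] b k c by auto
          thus ?thesis using neg_antimono[of b k] b k c by simp
        next
          case False
          thus ?thesis using c le_n[of "- k"] by (auto simp: cuts_def)
        qed
        moreover have "f (- k) \<in> cuts n f" using in_cuts[of "- k"] bk b k by simp
        ultimately have "{c \<in> cuts n f. c < f (- k) + 1} = insert (f (- k)) {c \<in> cuts n f. c < f (- i) + 1}"
          using less by (auto simp: not_less) (metis not_le)+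
        hence "cut_rank n f (f (- k) + 1) = Suc (cut_rank n f (f (- i) + 1))"
          using less by (simp add: cut_rank_def)
        thus ?thesis using 1 by simp
      next
        case False
        \<comment> \<open>A drop right after row \<open>k\<close> would make \<open>k\<close> the
          height of column \<open>f (- k)\<close>, hence a cut.\<close>
        have "f (- i) = f (- k)"
        proof (rule ccontr)
          assume "f (- i) \<noteq> f (- k)"
          hence less: "f (- i) < f (- k)" using le by simp
          let ?l = "f (- k)"
          have l: "1 \<le> ?l" "?l \<le> n" using less nonneg[of "- i"] le_n[of "- k"] by auto
          have "k \<le> f (- ?l)" using sym[of k ?l] k l by simp
          moreover have "\<not> i \<le> f (- ?l)" using sym[of i ?l] k l less by simp
          ultimately have "f (- ?l) = k" using k by simp
          hence "k \<in> cuts n f" using in_cuts[of "- ?l"] k l by simp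
          thus False using False by simp
        qed
        moreover have "c < i \<longleftrightarrow> c < k" if "c \<in> cuts n f" for c
          using that False k by (cases "c = k") auto
        hence "{c \<in> cuts n f. c < i} = {c \<in> cuts n f. c < k}" by blast
        ultimately show ?thesis by (simp add: cut_rank_def)
      qed
    qed
    thus ?case using step.IH by (auto simp: k_def)
  qed
  thus ?thesis using k by simp
qed

lemma code_in_codes:
  assumes im: "f \<in> pop_image n"
  shows "(word n f, 0 < f (- n)) \<in> codes n"
proof -
  interpret bracket n f using im by (simp add: pop_image_def)
  obtain k where k: "motzkin k (word n f)" using build_word(1)[OF im] by blast
  have "k \<noteq> 0" if "0 < f (- n)"
  proof
    assume "k = 0"
    hence "card (cuts n f) = 1"
      using length_stack[OF k, of n] build_word(3)[OF im] by simp
    moreover have "f (- n) \<in> cuts n f" "n \<in> cuts n f"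
      using that le_n[of "- n"] n_pos zero by (auto simp: cuts_def intro: exI[of _ "- n"] exI[of _ 0])
    ultimately have "f (- n) = n" by (metis card_1_singletonE singletonD)
    thus False using im by (simp add: pop_image_def)
  qed
  moreover have "int (length (word n f)) = n - 1" using n_pos by (simp add: word_def)
  ultimately show ?thesis using k by (auto simp: codes_def)
qed

lemma decode_code:
  assumes im: "f \<in> pop_image n"
  shows "decode n (word n f, 0 < f (- n)) = f"
proof
  fix a
  interpret bracket n f using im by (simp add: pop_image_def)
  let ?w = "word n f"
  let ?st = "stack n ?w" and ?d = "0 < f (- n)"
  interpret S: full_stack_machine n "ends n ?w" ?st ?d
    by (rule full_stack_machine_codes[OF code_in_codes[OF im]])
  have st: "?st = sorted_list_of_set (cuts n f)" by (rule build_word(3)[OF im])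
  have M: "length ?st = card (cuts n f)" by (simp add: st)
  have rank: "length (filter (\<lambda>c. c < x) ?st) = cut_rank n f x" for x
    by (simp add: st distinct_length_filter cut_rank_def Collect_conj_eq Int_commute)
  have S: "decode n (?w, ?d) = assemble n (ends n ?w) ?st ?d" by (simp add: decode_def)
  consider "a < - n \<or> n < a" | "a = 0" | "1 \<le> a" "a \<le> n" | "1 \<le> - a" "- a \<le> n" by linarith
  thus "decode n (?w, ?d) a = f a"
  proof cases
    case 1
    thus ?thesis using S.f_outside outside by (simp add: S)
  next
    case 2
    thus ?thesis using S.f_zero zero by (simp add: S)
  next
    case 3
    thus ?thesis using S.f_pos[OF 3] build_word(2)[OF im 3] by (simp add: S)
  next
    case 4
    define k where "k = - a"
    have k: "1 \<le> k" "k \<le> n" and a: "a = - k" using 4 by (auto simp: k_def)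
    have "f (- k) = 0 \<or> f (- k) \<in> cuts n f"
      using nonneg[of "- k"] le_n[of "- k"] k by (auto simp: cuts_def intro!: exI[of _ "- k"])
    hence "f (- k) \<in> set (0 # ?st)" by (auto simp: st)
    then obtain r where "r < length (0 # ?st)" and r: "(0 # ?st) ! r = f (- k)"
      by (metis in_set_conv_nth)
    hence rM: "r \<le> length ?st" by simp
    \<comment> \<open>The index of \<open>f (- k)\<close> is the number of cuts up to it, so
      \<open>cut_rank_sum\<close> becomes the index formula of \<open>staircase\<close>.\<close>
    have "cut_rank n f (f (- k) + 1) = r"
    proof (cases "r < length ?st")
      case True
      show ?thesis by (rule S.rank_Suc_nth[OF True, unfolded r rank])
    next
      case False
      hence "r = length ?st" using rM by simp
      hence "f (- k) = n" using S.last_cs r by simp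
      moreover have "{c \<in> cuts n f. c < n + 1} = cuts n f" by (auto simp: cuts_def)
      ultimately show ?thesis using M \<open>r = length ?st\<close> by (simp add: cut_rank_def)
    qed
    hence "length ?st + of_bool ?d - 1 - length (filter (\<lambda>c. c < k) ?st) = r"
      using cut_rank_sum[OF im k] rank M by simp
    thus ?thesis using S.f_neg[OF k] r a by (simp add: S staircase_def)
  qed
qed

lemma bij_betw_decode: "bij_betw (decode n) (codes n) (pop_image n)"
proof (rule bij_betw_byWitness[where f' = "\<lambda>f. (word n f, 0 < f (- n))"])
  show "\<forall>p\<in>codes n. (word n (decode n p), 0 < decode n p (- n)) = p"
  proof
    fix p assume "p \<in> codes n"
    obtain w d where p: "p = (w, d)" by (cases p)
    hence "(w, d) \<in> codes n" using \<open>p \<in> codes n\<close> by simp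
    thus "(word n (decode n p), 0 < decode n p (- n)) = p"
      unfolding p using word_decode full_stack_machine.f_neg_n_pos[OF full_stack_machine_codes]
      by (simp add: decode_def)
  qed
  show "\<forall>f\<in>pop_image n. decode n (word n f, 0 < f (- n)) = f" using decode_code by blast
  show "decode n ` codes n \<subseteq> pop_image n" using decode_in_pop_image by auto
  show "(\<lambda>f. (word n f, 0 < f (- n))) ` pop_image n \<subseteq> codes n" using code_in_codes by auto
qed

text \<open>Level letters are free by the choice in \<open>step_of\<close>, down letters by the
  image condition. Node \<open>n\<close> carries no letter and is not free because of the
  sentinel.\<close>

lemma card_free_ends:
  assumes im: "f \<in> pop_image n"
  shows "card (free_ends n f) = non_ups (word n f)"
proof -
  interpret bracket n f using im by (simp add: pop_image_def)
  have "non_ups (word n f) = length (filter (\<lambda>i. step_of f i \<noteq> Up) [1..n - 1])"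
    by (simp add: non_ups_def word_def filter_map comp_def)
  also have "\<dots> = card ({i. step_of f i \<noteq> Up} \<inter> {1..n - 1})"
    by (simp add: distinct_length_filter)
  also have "{i. step_of f i \<noteq> Up} \<inter> {1..n - 1} = free_ends n f"
  proof (intro Set.set_eqI iffI)
    fix i assume i: "i \<in> {i. step_of f i \<noteq> Up} \<inter> {1..n - 1}"
    have "f i \<notin> f ` {..<i}"
    proof (cases "i < f i")
      case True
      thus ?thesis using im i by (force simp: pop_image_def)
    next
      case False
      thus ?thesis using i by (auto simp: step_of_def split: if_splits)
    qed
    thus "i \<in> free_ends n f" using i by (auto simp: free_ends_def)
  next
    fix i assume i: "i \<in> free_ends n f"
    thus "i \<in> {i. step_of f i \<noteq> Up} \<inter> {1..n - 1}"
      using free_endsD[OF i] by (auto simp: free_ends_def step_of_def)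
  qed
  finally show ?thesis by simp
qed

lemma card_upper_covers_decode:
  assumes "motzkin k w" "(w, d) \<in> codes n"
  shows "card {g. covers_in (brackets n) (decode n (w, d)) g} =
    non_ups w + (if d then (k + 1) div 2 else (k + 2) div 2)"
proof -
  let ?f = "decode n (w, d)"
  have im: "?f \<in> pop_image n" using decode_in_pop_image assms by simp
  hence "bracket n ?f" by (simp add: pop_image_def)
  hence "card {g. covers_in (brackets n) ?f g} = card (free_ends n ?f) + card (outer_corners n ?f)"
    using bracket.card_upper_covers im by blast
  moreover have "card (outer_corners n ?f) = (if d then (k + 1) div 2 else (k + 2) div 2)"
    using full_stack_machine.card_outer_corners[OF full_stack_machine_codes[OF assms(2)]]
      length_stack[OF assms(1), of n] by (simp add: decode_def)
  ultimately show ?thesis using card_free_ends[OF im] word_decode[OF assms(2)] by simp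
qed

lemma sum_pop_image:
  assumes "N \<ge> 1"
  shows "(\<Sum>f\<in>pop_image (int N). monom (1 :: int) (card {g. covers_in (brackets (int N)) f g})) =
    (\<Sum>k<N. motzkin_poly (N - 1) k * run_weight k)"
proof -
  let ?n = "int N"
  let ?X = "\<lambda>k. motzkin_words (N - 1) k \<times> (if k = 0 then {False} else UNIV)"
  have codes: "codes ?n = (\<Union>k\<in>{..<N}. ?X k)"
  proof (intro Set.set_eqI iffI)
    fix p assume "p \<in> codes ?n"
    then obtain w d k where p: "p = (w, d)" "int (length w) = ?n - 1" "motzkin k w" "d \<longrightarrow> k \<noteq> 0"
      by (auto simp: codes_def)
    moreover from this have "k < N" using motzkin_height_le[of k w] by linarith
    moreover have "length w = N - 1" using p assms by linarith
    ultimately show "p \<in> (\<Union>k\<in>{..<N}. ?X k)"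
      by (auto simp: motzkin_words_def intro!: bexI[of _ k])
  next
    fix p assume "p \<in> (\<Union>k\<in>{..<N}. ?X k)"
    thus "p \<in> codes ?n" using assms
      by (auto simp: codes_def motzkin_words_def of_nat_diff split: if_splits)
  qed
  have "(\<Sum>f\<in>pop_image ?n. monom (1 :: int) (card {g. covers_in (brackets ?n) f g})) =
      (\<Sum>p\<in>codes ?n. monom 1 (card {g. covers_in (brackets ?n) (decode ?n p) g}))"
    using sum.reindex_bij_betw[OF bij_betw_decode[of ?n],
        of "\<lambda>f. monom (1 :: int) (card {g. covers_in (brackets ?n) f g})"] by simp
  also have "\<dots> = (\<Sum>k<N. \<Sum>p\<in>?X k. monom 1 (card {g. covers_in (brackets ?n) (decode ?n p) g}))"
    unfolding codes
  proof (rule sum.UNION_disjoint)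
    show "\<forall>k\<in>{..<N}. finite (?X k)" by simp
    show "\<forall>k\<in>{..<N}. \<forall>l\<in>{..<N}. k \<noteq> l \<longrightarrow> ?X k \<inter> ?X l = {}"
      by (auto simp: motzkin_words_def dest: motzkin_height_unique)
  qed simp
  also have "\<dots> = (\<Sum>k<N. motzkin_poly (N - 1) k * run_weight k)"
  proof (rule sum.cong)
    fix k assume k: "k \<in> {..<N}"
    have "(\<Sum>p\<in>?X k. monom (1::int) (card {g. covers_in (brackets ?n) (decode ?n p) g})) =
        (\<Sum>(w, d)\<in>?X k. monom 1 (non_ups w) * monom 1 (if d then (k + 1) div 2 else (k + 2) div 2))"
    proof (rule sum.cong)
      fix p assume p: "p \<in> ?X k"
      have "p \<in> codes ?n" unfolding codes using k p by (rule UN_I)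
      moreover obtain w d where wd: "p = (w, d)" by (cases p)
      ultimately show "monom (1::int) (card {g. covers_in (brackets ?n) (decode ?n p) g}) =
          (case p of (w, d) \<Rightarrow> monom 1 (non_ups w) * monom 1 (if d then (k + 1) div 2 else (k + 2) div 2))"
        using card_upper_covers_decode[of k w d ?n] p by (simp add: motzkin_words_def mult_monom)
    qed simp
    also have "\<dots> = motzkin_poly (N - 1) k *
        (\<Sum>d\<in>(if k = 0 then {False} else UNIV). monom 1 (if d then (k + 1) div 2 else (k + 2) div 2))"
      unfolding motzkin_poly_def sum_product by (simp add: sum.cartesian_product)
    also have "(\<Sum>d\<in>(if k = 0 then {False} else UNIV). monom (1::int) (if d then (k + 1) div 2 else (k + 2) div 2)) =
        run_weight k"
      by (simp add: run_weight_def UNIV_bool)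
    finally show "(\<Sum>p\<in>?X k. monom (1::int) (card {g. covers_in (brackets ?n) (decode ?n p) g})) =
        motzkin_poly (N - 1) k * run_weight k" .
  qed simp
  finally show ?thesis .
qed

theorem mainTheorem2:
  fixes n :: nat
  assumes "n \<ge> 1"
  shows "Pop_poly (TamB n) =
         Sum_any (\<lambda>k::nat. monom (of_nat (((n - 1) choose k) * ((n - k + 1) choose k))) (n - k))"
  unfolding Pop_poly_TamB[OF assms] image_pop_brackets sum_pop_image[OF assms]
  by (rule sum_motzkin_binomial[OF assms])

end
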